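(* Let $n\ge1$, $\bm{N}=(N_0,\ldots,N_{n-1},-\sum_{i<n}N_i)\in\mathbb{Z}^{n+1}$, let $\bm{f}$ be any (not necessarily integer) point of $\mathcal{F}_n(\bm{N})$, let $s_k=\sum_{j=0}^kN_j$, and let $A=(a_{ij})=A(\bm{f})$. Then \[ K_n(\bm{N})\;\geq\;\max_{0\le i\le n-1}\Big\{\frac{(s_i+1)^{s_i+1}}{s_i^{s_i}}\Big\}\Big[\prod_{i=0}^{n-1}\frac{s_i^{s_i}}{(s_i+1)^{s_i+1}}\Big]^2\prod_{\substack{0\le i,j\le n-1\\ i+j\le n}}\frac{(a_{ij}+1)^{a_{ij}+1}}{a_{ij}^{a_{ij}}}. \]
   Context: $\mathcal{F}_n(\bm{N})$ is the set of $\bm{f}=(f_{ij})_{0\le i<j\le n}\in\mathbb{R}_{\ge0}^{\binom{n+1}{2}}$ with $\sum_{j>i} f_{ij}-\sum_{k<i} f_{ki}=N_i$ for every $i$, and $K_n(\bm{N})$ is its number of integer points. For $\bm{f}\in\mathcal{F}_n(\bm{N})$, $A(\bm{f})=(a_{ij})_{0\le i,j\le n-1}$ is defined by $a_{ij}=f_{i,n-j}$ if $i+j\le n-1$, $a_{i,n-i}=\sum_{0\le k<i}(N_k-f_{k,i})$ for $1\le i\le n-1$, and $a_{ij}=0$ if $i+j>n$. Convention $0^0=1$. *)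

theory Defs
  imports Complex_Main
begin

text \<open>Flows on the complete graph on vertices 0..n: f i j is the flow on edge (i,j), i<j<=n.
  Functions are required to vanish outside these edges so that the set of integer points is
  a genuine finite set of functions.\<close>
definition flow_polytope :: "nat \<Rightarrow> (nat \<Rightarrow> int) \<Rightarrow> (nat \<Rightarrow> nat \<Rightarrow> real) set" where
  "flow_polytope n N = {f.
     (\<forall>i j. \<not> (i < j \<and> j \<le> n) \<longrightarrow> f i j = 0) \<and>
     (\<forall>i j. i < j \<and> j \<le> n \<longrightarrow> f i j \<ge> 0) \<and>
     (\<forall>i\<le>n. (\<Sum>j\<in>{i<..n}. f i j) - (\<Sum>k<i. f k i) = of_int (N i))}"

definition K_count :: "nat \<Rightarrow> (nat \<Rightarrow> int) \<Rightarrow> nat" where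
  "K_count n N = card {f \<in> flow_polytope n N. \<forall>i j. f i j \<in> \<int>}"

definition A_mat :: "nat \<Rightarrow> (nat \<Rightarrow> int) \<Rightarrow> (nat \<Rightarrow> nat \<Rightarrow> real) \<Rightarrow> nat \<Rightarrow> nat \<Rightarrow> real" where
  "A_mat n N f i j =
     (if i + j \<le> n - 1 then f i (n - j)
      else if i + j = n \<and> 1 \<le> i then (\<Sum>k<i. (of_int (N k) - f k i))
      else 0)"

definition selfpow :: "real \<Rightarrow> real" where
  "selfpow x = (if x = 0 then 1 else x powr x)"

end

theory Submission
  imports Defs "HOL-Library.Multiset" "HOL-Library.FuncSet"
begin

text \<open>
  Integer flows correspond to nonnegative integer tables supported on \<open>i + j \<le> n\<close> with row sums
  \<open>s i\<close> and column sums \<open>s (n - 1 - j)\<close>, and \<open>A_mat\<close> is a real table with the same margins.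
  The number of such tables is a coefficient of \<open>\<Prod> 1 / (1 - x i * y j)\<close>, and it is extracted one variable
  at a time.  Each extraction costs a factor \<open>k\<^sup>k / (k + 1)\<^sup>k\<^sup>+\<^sup>1\<close>, provided the coefficients form a log-concave
  sequence in the variable being extracted: such a sequence is dominated by a geometric one.
  The remaining infimum of the generating function is bounded below termwise, since
  \<open>(a + 1) powr (a + 1) / a powr a * q powr a \<le> 1 / (1 - q)\<close>.

  Log-concavity is a shadow of a Lorentzian property: all matrices \<open>c (\<mu> + a + b)\<close> formed from an array \<open>c\<close>
  have at most one positive eigenvalue.  Separable log-concave arrays have this property, and it survives
  adding one cell of the table, i.e. passing to \<open>\<Sum>k. t ^ k * c (\<mu> - k y + k u)\<close>: the new forms
  arise from the old ones by repeatedly restricting an orthogonal sum of two forms with one positive eigenvalue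
  each and splitting off a positive square.
\<close>

subsection \<open>Gluing quadratic forms with one positive eigenvalue\<close>

text \<open>A form with positive leading coefficient grows without bound in \<eta>, so a square that
  dominates it must depend on \<eta>. In \<open>glue\<close> this keeps the denominator
  \<open>D\<close> positive.\<close>

lemma quadratic_bound_slope_nonzero:
  fixes c \<beta> \<gamma> \<xi> \<delta> :: real
  assumes "c > 0" and le: "\<And>\<eta>. \<gamma> + 2 * \<eta> * \<beta> + \<eta>\<^sup>2 * c \<le> (\<delta> + \<xi> * \<eta>)\<^sup>2"
  shows "\<xi> \<noteq> 0"
proof
  assume "\<xi> = 0"
  \<comment> \<open>Adding the bounds at \<eta> and -\<eta> removes the linear term. This \<eta> is
    at least 1, so \<eta> is at most its own square, and already \<eta> times \<open>c\<close>
    exceeds the constant that remains.\<close>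
  define \<eta> where "\<eta> = 1 + \<bar>\<delta>\<^sup>2 - \<gamma>\<bar> / c"
  have "\<gamma> + 2 * \<eta> * \<beta> + \<eta>\<^sup>2 * c \<le> \<delta>\<^sup>2" "\<gamma> - 2 * \<eta> * \<beta> + \<eta>\<^sup>2 * c \<le> \<delta>\<^sup>2"
    using le[of \<eta>] le[of "-\<eta>"] \<open>\<xi> = 0\<close> by simp_all
  then have 1: "\<eta>\<^sup>2 * c \<le> \<delta>\<^sup>2 - \<gamma>" by linarith
  have "\<eta> \<ge> 1" using \<open>c > 0\<close> by (simp add: \<eta>_def)
  then have "\<eta> \<le> \<eta>\<^sup>2" by (simp add: power2_eq_square)
  then have "\<eta> * c \<le> \<eta>\<^sup>2 * c" using \<open>c > 0\<close> by simp
  moreover have "\<eta> * c = c + \<bar>\<delta>\<^sup>2 - \<gamma>\<bar>" using \<open>c > 0\<close> by (simp add: \<eta>_def field_simps)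
  ultimately show False using 1 \<open>c > 0\<close> by linarith
qed

text \<open>The hypothesis concerns the quadratic forms of an array at \<open>u\<^sup>k y\<^sup>r\<^sup>-\<^sup>k\<close>, with \<open>\<eta>\<close> and \<open>\<omega>\<close> the
  coordinates along \<open>u\<close> and \<open>y\<close>; the conclusion at \<open>p = q\<close> is the form of the array summed over \<open>k\<close>.
  The induction on \<open>r\<close> needs the stronger three-variable shape.\<close>

lemma glue:
  fixes F :: "('x \<Rightarrow> real) set" and a b :: "nat \<Rightarrow> 'x \<Rightarrow> real" and c :: "nat \<Rightarrow> real"
  assumes lin: "\<And>f g \<alpha> \<beta>. f \<in> F \<Longrightarrow> g \<in> F \<Longrightarrow> (\<lambda>x. \<alpha> * f x + \<beta> * g x) \<in> F"
    and pos: "\<And>j. c j > 0"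
    and hyp: "\<And>k. k \<le> r \<Longrightarrow> \<exists>L\<in>F. \<exists>\<xi> \<kappa>. \<forall>x \<eta> \<omega>.
       a k x + 2 * \<eta> * b (k + 1) x + 2 * \<omega> * b k x
         + \<eta>\<^sup>2 * c (k + 2) + 2 * \<eta> * \<omega> * c (k + 1) + \<omega>\<^sup>2 * c k \<le> (L x + \<xi> * \<eta> + \<kappa> * \<omega>)\<^sup>2"
  shows "\<exists>L\<in>F. \<exists>\<xi> \<kappa>. \<forall>x p q.
       (\<Sum>k\<le>r. a k x) + 2 * p * (\<Sum>j\<le>r. b (j + 1) x) + 2 * q * b 0 x
         + (\<Sum>j\<le>r. c (j + 2)) * p\<^sup>2 + 2 * c 1 * p * q + (c 0 - c 1) * q\<^sup>2 \<le> (L x + \<xi> * p + \<kappa> * q)\<^sup>2"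
  using pos hyp
proof (induction r arbitrary: a b c)
  case 0
  obtain L \<xi> \<kappa> where L: "L \<in> F" and le: "\<And>x \<eta> \<omega>. a 0 x + 2 * \<eta> * b 1 x + 2 * \<omega> * b 0 x
         + \<eta>\<^sup>2 * c 2 + 2 * \<eta> * \<omega> * c 1 + \<omega>\<^sup>2 * c 0 \<le> (L x + \<xi> * \<eta> + \<kappa> * \<omega>)\<^sup>2"
    using "0.prems"(2)[of 0] by (auto simp: numeral_2_eq_2)
  have "a 0 x + 2 * p * b 1 x + 2 * q * b 0 x + c 2 * p\<^sup>2 + 2 * c 1 * p * q + (c 0 - c 1) * q\<^sup>2
      \<le> (L x + \<xi> * p + \<kappa> * q)\<^sup>2" for x p q
  proof -
    \<comment> \<open>With a single term, the claimed form is the given one at \<eta> = p, \<omega>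
      = q minus this square.\<close>
    have "0 \<le> c 1 * q\<^sup>2" using "0.prems"(1)[of 1] by simp
    then show ?thesis using le[of x p q] by (simp add: algebra_simps)
  qed
  then show ?case using L by (auto simp: numeral_2_eq_2)
next
  case (Suc r)
  \<comment> \<open>The induction hypothesis, applied to the shifted sequences, glues the terms from
    index 1 on; the term of index 0 is attached afterwards.\<close>
  have "\<exists>L\<in>F. \<exists>\<xi> \<kappa>. \<forall>x p q.
       (\<Sum>k\<le>r. a (Suc k) x) + 2 * p * (\<Sum>j\<le>r. b (Suc (j + 1)) x) + 2 * q * b (Suc 0) x
         + (\<Sum>j\<le>r. c (Suc (j + 2))) * p\<^sup>2 + 2 * c (Suc 1) * p * q + (c (Suc 0) - c (Suc 1)) * q\<^sup>2
       \<le> (L x + \<xi> * p + \<kappa> * q)\<^sup>2"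
    by (rule Suc.IH[of "\<lambda>k. c (Suc k)" "\<lambda>k. a (Suc k)" "\<lambda>k. b (Suc k)"])
       (use Suc.prems(1) Suc.prems(2)[of "Suc k" for k] in \<open>auto\<close>)
  then obtain L1 \<xi>1 \<kappa>1 where L1: "L1 \<in> F" and le1: "\<And>x p q.
       (\<Sum>k\<le>r. a (Suc k) x) + 2 * p * (\<Sum>j\<le>r. b (j + 2) x) + 2 * q * b 1 x
         + (\<Sum>j\<le>r. c (j + 3)) * p\<^sup>2 + 2 * c 2 * p * q + (c 1 - c 2) * q\<^sup>2
       \<le> (L1 x + \<xi>1 * p + \<kappa>1 * q)\<^sup>2" by (auto simp: numeral_3_eq_3 numeral_2_eq_2)
  obtain L2 \<xi>2 \<kappa>2 where L2: "L2 \<in> F" and le2: "\<And>x \<eta> \<omega>. a 0 x + 2 * \<eta> * b 1 x + 2 * \<omega> * b 0 x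
         + \<eta>\<^sup>2 * c 2 + 2 * \<eta> * \<omega> * c 1 + \<omega>\<^sup>2 * c 0 \<le> (L2 x + \<xi>2 * \<eta> + \<kappa>2 * \<omega>)\<^sup>2"
    using Suc.prems(2)[of 0] by (auto simp: numeral_2_eq_2)
  have "\<xi>2 \<noteq> 0"
  proof (rule quadratic_bound_slope_nonzero[of "c 2"])
    show "c 2 > 0" by (rule Suc.prems(1))
    show "a 0 x + 2 * \<eta> * b 1 x + \<eta>\<^sup>2 * c 2 \<le> (L2 x + \<xi>2 * \<eta>)\<^sup>2" for \<eta> x
      using le2[of x \<eta> 0] by simp
  qed
  \<comment> \<open>The two bounds will share one free variable \<open>u\<close> and add up to
    \<open>(X - \<kappa>1 * u)^2 + (Y + \<xi>2 * u)^2\<close>. Its minimum over \<open>u\<close> is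
    the single square of \<open>(\<xi>2 * X + \<kappa>1 * Y) / sqrt D\<close>; \<open>L\<close>,
    \<xi>, \<kappa> are read off from this expression.\<close>
  define D where "D = \<kappa>1\<^sup>2 + \<xi>2\<^sup>2"
  have "D > 0" using \<open>\<xi>2 \<noteq> 0\<close> by (simp add: D_def add_nonneg_pos)
  define L where "L = (\<lambda>x. (\<xi>2 / sqrt D) * L1 x + (\<kappa>1 / sqrt D) * L2 x)"
  define \<xi> where "\<xi> = \<xi>2 * (\<xi>1 + \<kappa>1) / sqrt D"
  define \<kappa> where "\<kappa> = \<kappa>1 * \<kappa>2 / sqrt D"
  have "(\<Sum>k\<le>Suc r. a k x) + 2 * p * (\<Sum>j\<le>Suc r. b (j + 1) x) + 2 * q * b 0 x
         + (\<Sum>j\<le>Suc r. c (j + 2)) * p\<^sup>2 + 2 * c 1 * p * q + (c 0 - c 1) * q\<^sup>2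
       \<le> (L x + \<xi> * p + \<kappa> * q)\<^sup>2" (is "?M \<le> _") for x p q
  proof -
    define X where "X = L1 x + (\<xi>1 + \<kappa>1) * p"
    define Y where "Y = L2 x + \<kappa>2 * q"
    define u where "u = (\<kappa>1 * X - \<xi>2 * Y) / D"
    have s: "(\<Sum>k\<le>Suc r. a k x) = a 0 x + (\<Sum>k\<le>r. a (Suc k) x)"
      "(\<Sum>j\<le>Suc r. b (j + 1) x) = b 1 x + (\<Sum>j\<le>r. b (j + 2) x)"
      "(\<Sum>j\<le>Suc r. c (j + 2)) = c 2 + (\<Sum>j\<le>r. c (j + 3))"
      by (simp_all only: sum.atMost_Suc_shift) (simp_all add: numeral_3_eq_3 numeral_2_eq_2)
    \<comment> \<open>Completing the square in \<open>u\<close>: the glued form plus a nonnegative square is the sum of the two given forms.\<close>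
    have "?M + c 1 * (u - (p - q))\<^sup>2
       = ((\<Sum>k\<le>r. a (Suc k) x) + 2 * p * (\<Sum>j\<le>r. b (j + 2) x) + 2 * (p - u) * b 1 x
         + (\<Sum>j\<le>r. c (j + 3)) * p\<^sup>2 + 2 * c 2 * p * (p - u) + (c 1 - c 2) * (p - u)\<^sup>2)
        + (a 0 x + 2 * u * b 1 x + 2 * q * b 0 x + u\<^sup>2 * c 2 + 2 * u * q * c 1 + q\<^sup>2 * c 0)"
      unfolding s by (simp add: power2_eq_square algebra_simps)
    also have "\<dots> \<le> (L1 x + \<xi>1 * p + \<kappa>1 * (p - u))\<^sup>2 + (L2 x + \<xi>2 * u + \<kappa>2 * q)\<^sup>2"
      by (rule add_mono[OF le1 le2])
    also have "\<dots> = (X - \<kappa>1 * u)\<^sup>2 + (Y + \<xi>2 * u)\<^sup>2"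
      by (simp add: X_def Y_def algebra_simps)
    also have "X - \<kappa>1 * u = \<xi>2 * (\<xi>2 * X + \<kappa>1 * Y) / D"
      using \<open>D > 0\<close> by (simp add: u_def field_simps) (simp add: D_def power2_eq_square algebra_simps)
    also have "Y + \<xi>2 * u = \<kappa>1 * (\<xi>2 * X + \<kappa>1 * Y) / D"
      using \<open>D > 0\<close> by (simp add: u_def field_simps) (simp add: D_def power2_eq_square algebra_simps)
    also have "(\<xi>2 * (\<xi>2 * X + \<kappa>1 * Y) / D)\<^sup>2 + (\<kappa>1 * (\<xi>2 * X + \<kappa>1 * Y) / D)\<^sup>2
        = (\<xi>2\<^sup>2 + \<kappa>1\<^sup>2) * (\<xi>2 * X + \<kappa>1 * Y)\<^sup>2 / D\<^sup>2"
      by (simp add: power_divide power_mult_distrib distrib_right add_divide_distrib)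
    also have "\<xi>2\<^sup>2 + \<kappa>1\<^sup>2 = D" by (simp add: D_def)
    also have "D * (\<xi>2 * X + \<kappa>1 * Y)\<^sup>2 / D\<^sup>2 = ((\<xi>2 * X + \<kappa>1 * Y) / sqrt D)\<^sup>2"
      using \<open>D > 0\<close> by (simp add: power_divide) (simp add: power2_eq_square)
    also have "(\<xi>2 * X + \<kappa>1 * Y) / sqrt D = L x + \<xi> * p + \<kappa> * q"
      by (simp add: X_def Y_def L_def \<xi>_def \<kappa>_def algebra_simps add_divide_distrib)
    finally show ?thesis
      using mult_nonneg_nonneg[OF less_imp_le[OF Suc.prems(1)[of 1]] zero_le_power2[of "u - (p - q)"]]
      by linarith
  qed
  moreover have "L \<in> F" unfolding L_def by (rule lin[OF L1 L2])
  ultimately show ?case by blast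
qed

subsection \<open>Lorentzian arrays indexed by multisets\<close>

definition quad :: "('v \<Rightarrow> 'v \<Rightarrow> real) \<Rightarrow> 'v set \<Rightarrow> ('v \<Rightarrow> real) \<Rightarrow> real" where
  "quad M V x = (\<Sum>a\<in>V. \<Sum>b\<in>V. x a * x b * M a b)"

lemma quad_cong:
  "(\<And>a. a \<in> V \<Longrightarrow> x a = x' a) \<Longrightarrow> (\<And>a b. a \<in> V \<Longrightarrow> b \<in> V \<Longrightarrow> M a b = M' a b) \<Longrightarrow> quad M V x = quad M' V x'"
  by (simp add: quad_def)

lemma quad_insert:
  assumes "finite V" "y \<notin> V" and sym: "\<And>a b. M a b = M b a"
  shows "quad M (insert y V) x = quad M V x + 2 * x y * (\<Sum>v\<in>V. x v * M y v) + (x y)\<^sup>2 * M y y"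
proof -
  have "(\<Sum>a\<in>V. x a * x y * M a y) = x y * (\<Sum>v\<in>V. x v * M y v)"
    by (simp add: sum_distrib_left sym[of _ y] algebra_simps)
  moreover have "(\<Sum>b\<in>V. x y * x b * M y b) = x y * (\<Sum>v\<in>V. x v * M y v)"
    by (simp add: sum_distrib_left algebra_simps)
  ultimately show ?thesis
    using assms(1,2) by (simp add: quad_def sum.distrib power2_eq_square algebra_simps)
qed

lemma quad_upd:
  assumes "finite V" "u \<in> V" and sym: "\<And>a b. M a b = M b a"
  shows "quad M V (x(u := x u + \<eta>)) = quad M V x + 2 * \<eta> * (\<Sum>v\<in>V. x v * M u v) + \<eta>\<^sup>2 * M u u"
proof -
  define V' where "V' = V - {u}"
  have V: "V = insert u V'" "u \<notin> V'" "finite V'" using assms by (auto simp: V'_def)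
  have 1: "quad M V' (x(u := x u + \<eta>)) = quad M V' x"
    using V by (intro quad_cong) auto
  have 2: "(\<Sum>v\<in>V'. (x(u := x u + \<eta>)) v * M u v) = (\<Sum>v\<in>V'. x v * M u v)"
    using V by (intro sum.cong) auto
  show ?thesis
    unfolding V(1) quad_insert[OF V(3,2) sym] 1 2 using V(2,3)
    by (simp add: power2_eq_square algebra_simps)
qed

text \<open>A quadratic form has at most one positive eigenvalue iff it is bounded above by the square of a
  linear form.  No homogeneity is imposed: the condition only relates values at multisets of equal size.\<close>

definition lorentzian :: "'v set \<Rightarrow> ('v multiset \<Rightarrow> real) \<Rightarrow> bool" where
  "lorentzian V c \<longleftrightarrow> (\<forall>\<mu>. c \<mu> > 0) \<and>
     (\<forall>\<mu>. \<exists>l. \<forall>x. quad (\<lambda>a b. c (add_mset a (add_mset b \<mu>))) V x \<le> (\<Sum>v\<in>V. l v * x v)\<^sup>2)"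

text \<open>On generating functions this is multiplication by \<open>1 / (1 - t y / u)\<close>, dropping negative powers of \<open>u\<close>.\<close>

definition transfer_mass :: "'v \<Rightarrow> 'v \<Rightarrow> real \<Rightarrow> ('v multiset \<Rightarrow> real) \<Rightarrow> 'v multiset \<Rightarrow> real" where
  "transfer_mass u y t c \<mu> =
     (\<Sum>k\<le>count \<mu> y. t ^ k * c (\<mu> - replicate_mset k y + replicate_mset k u))"

lemma transfer_mass_eval:
  assumes "y \<notin># \<nu>"
  shows "transfer_mass u y t c (\<nu> + replicate_mset n y) =
     (\<Sum>k\<le>n. t ^ k * c (\<nu> + replicate_mset k u + replicate_mset (n - k) y))"
proof -
  have "count (\<nu> + replicate_mset n y) y = n" using assms by (simp add: not_in_iff)
  moreover have "\<nu> + replicate_mset n y - replicate_mset k y + replicate_mset k u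
      = \<nu> + replicate_mset k u + replicate_mset (n - k) y" if "k \<le> n" for k
    using that by (auto simp: multiset_eq_iff)
  ultimately show ?thesis unfolding transfer_mass_def by (intro sum.cong) (simp_all only: atMost_iff)
qed

text \<open>Sorting the new form by the number k of transferred units expresses it through the old
  forms at k copies of \<open>u\<close> and r - k copies of \<open>y\<close>. These overlap in the
  coordinates along \<open>u\<close> and \<open>y\<close> exactly as in \<open>glue\<close>, which
  is then used at \<open>p = q = x y\<close>.\<close>

lemma lorentzian_transfer_mass:
  assumes c: "lorentzian V c" and V: "finite V" "u \<in> V" "y \<in> V" "u \<noteq> y" and "t > 0"
  shows "lorentzian V (transfer_mass u y t c)"
proof -
  have pos: "c \<mu> > 0" for \<mu> using c by (simp add: lorentzian_def)
  have "\<exists>l. \<forall>x. quad (\<lambda>a b. transfer_mass u y t c (add_mset a (add_mset b \<mu>))) V x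
          \<le> (\<Sum>v\<in>V. l v * x v)\<^sup>2" for \<mu>
  proof -
    define r where "r = count \<mu> y"
    define \<nu> where "\<nu> = filter_mset (\<lambda>v. v \<noteq> y) \<mu>"
    have \<nu>: "y \<notin># \<nu>" "\<mu> = \<nu> + replicate_mset r y"
      by (auto simp: \<nu>_def r_def multiset_eq_iff)
    define V' where "V' = V - {y}"
    have V': "V = insert y V'" "y \<notin> V'" "finite V'" "u \<in> V'" using V by (auto simp: V'_def)
    \<comment> \<open>\<open>C j n \<sigma>\<close> is the term in which j of n copies of
      \<open>y\<close> have moved, with further elements \<sigma>. Then \<open>a\<close>,
      \<open>b\<close>, \<open>c'\<close> are the parts that are quadratic, linear and constant in
      the coordinates other than \<open>y\<close>.\<close>
    define C where "C = (\<lambda>j n \<sigma>. t ^ j * c (\<nu> + replicate_mset j u + replicate_mset (n - j) y + \<sigma>))"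
    define a where "a = (\<lambda>k x. quad (\<lambda>v w. C k r {#v, w#}) V' x)"
    define b where "b = (\<lambda>k x. \<Sum>v\<in>V'. x v * C k (r + 1) {#v#})"
    define c' where "c' = (\<lambda>k. C k (r + 2) {#})"
    define F where "F = range (\<lambda>l x. \<Sum>v\<in>V'. l v * x v :: real)"
    have Q: "\<exists>L\<in>F. \<exists>\<xi> \<kappa>. \<forall>x \<eta> \<omega>.
       a k x + 2 * \<eta> * b (k + 1) x + 2 * \<omega> * b k x
         + \<eta>\<^sup>2 * c' (k + 2) + 2 * \<eta> * \<omega> * c' (k + 1) + \<omega>\<^sup>2 * c' k \<le> (L x + \<xi> * \<eta> + \<kappa> * \<omega>)\<^sup>2"
      if "k \<le> r" for k
    proof -
      define \<rho> where "\<rho> = \<nu> + replicate_mset k u + replicate_mset (r - k) y"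
      define M where "M = (\<lambda>v w. t ^ k * c (add_mset v (add_mset w \<rho>)))"
      have sym: "M v w = M w v" for v w by (simp add: M_def add_mset_commute)
      obtain l where l: "\<And>x. quad (\<lambda>a b. c (add_mset a (add_mset b \<rho>))) V x \<le> (\<Sum>v\<in>V. l v * x v)\<^sup>2"
        using c unfolding lorentzian_def by blast
      \<comment> \<open>The root lets the factor \<open>t ^ k\<close> be absorbed into the linear
        form.\<close>
      define s where "s = sqrt (t ^ k)"
      have s2: "s\<^sup>2 = t ^ k" using \<open>t > 0\<close> by (simp add: s_def)
      have lM: "quad M V x \<le> (s * (\<Sum>v\<in>V. l v * x v))\<^sup>2" for x
      proof -
        have "quad M V x = t ^ k * quad (\<lambda>a b. c (add_mset a (add_mset b \<rho>))) V x"
          by (simp add: quad_def M_def sum_distrib_left algebra_simps)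
        also have "\<dots> \<le> t ^ k * (\<Sum>v\<in>V. l v * x v)\<^sup>2"
          using l \<open>t > 0\<close> by (intro mult_left_mono) auto
        finally show ?thesis by (simp add: power_mult_distrib s2)
      qed
      \<comment> \<open>An index \<open>y\<close> adds a copy that stays; an index \<open>u\<close>
        adds a copy that counts as moved, which is why it needs one more factor
        \<open>t\<close>.\<close>
      have e: "M v w = C k r {#v, w#}" "M y v = C k (r + 1) {#v#}" "t * M u v = C (k + 1) (r + 1) {#v#}"
        "M y y = c' k" "t * M y u = c' (k + 1)" "t\<^sup>2 * M u u = c' (k + 2)" for v w
        using that by (simp_all add: M_def C_def c'_def \<rho>_def Suc_diff_le add_mset_commute power2_eq_square)
      have "a k x + 2 * \<eta> * b (k + 1) x + 2 * \<omega> * b k x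
         + \<eta>\<^sup>2 * c' (k + 2) + 2 * \<eta> * \<omega> * c' (k + 1) + \<omega>\<^sup>2 * c' k
         \<le> ((\<Sum>v\<in>V'. (s * l v) * x v) + s * l u * t * \<eta> + s * l y * \<omega>)\<^sup>2" (is "?l \<le> ?r") for x \<eta> \<omega>
      proof -
        \<comment> \<open>The old form is tested at \<open>x\<close> shifted by
          \<open>t * \<eta>\<close> along \<open>u\<close>, with coordinate \<omega> along
          \<open>y\<close>.\<close>
        define x' where "x' = x(u := x u + t * \<eta>)"
        have lin': "(\<Sum>v\<in>V'. g v * x' v) = (\<Sum>v\<in>V'. g v * x v) + g u * t * \<eta>" for g
        proof -
          have "(\<Sum>v\<in>V'. g v * x' v) = g u * x' u + (\<Sum>v\<in>V' - {u}. g v * x' v)"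
            using V' by (simp add: sum.remove)
          also have "(\<Sum>v\<in>V' - {u}. g v * x' v) = (\<Sum>v\<in>V' - {u}. g v * x v)"
            by (intro sum.cong) (auto simp: x'_def)
          finally show ?thesis using V' by (simp add: sum.remove x'_def algebra_simps)
        qed
        define z where "z = x'(y := \<omega>)"
        have z: "z y = \<omega>" "v \<in> V' \<Longrightarrow> z v = x' v" for v using V'(2) by (auto simp: z_def)
        have "quad M V z = quad M V' x' + 2 * \<omega> * (\<Sum>v\<in>V'. M y v * x' v) + \<omega>\<^sup>2 * M y y"
          unfolding V'(1) quad_insert[OF V'(3,2) sym] z(1)
          by (simp add: z(2) mult.commute cong: quad_cong sum.cong)
        also have "quad M V' x' = quad M V' x + 2 * (t * \<eta>) * (\<Sum>v\<in>V'. x v * M u v) + (t * \<eta>)\<^sup>2 * M u u"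
          unfolding x'_def by (rule quad_upd[OF V'(3,4) sym])
        finally have "quad M V z = quad M V' x + 2 * \<eta> * (\<Sum>v\<in>V'. x v * (t * M u v)) + \<eta>\<^sup>2 * (t\<^sup>2 * M u u)
            + 2 * \<omega> * (\<Sum>v\<in>V'. x v * M y v) + 2 * \<eta> * \<omega> * (t * M y u) + \<omega>\<^sup>2 * M y y"
          unfolding lin' by (simp add: power_mult_distrib sum_distrib_left algebra_simps)
        then have "?l = quad M V z"
          unfolding e(4-6) unfolding e(2,3) a_def b_def e(1)[symmetric] by simp
        also have "\<dots> \<le> (s * (\<Sum>v\<in>V. l v * z v))\<^sup>2" by (rule lM)
        also have "(\<Sum>v\<in>V. l v * z v) = l y * \<omega> + (\<Sum>v\<in>V'. l v * x' v)"
          using V'(1-3) by (simp add: z)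
        also have "(s * (l y * \<omega> + (\<Sum>v\<in>V'. l v * x' v)))\<^sup>2 = ?r"
          unfolding lin' by (simp add: sum_distrib_left algebra_simps)
        finally show ?thesis .
      qed
      moreover have "(\<lambda>x. \<Sum>v\<in>V'. (s * l v) * x v) \<in> F" unfolding F_def by (rule range_eqI[of _ _ "\<lambda>v. s * l v"]) simp
      ultimately show ?thesis
        by (intro bexI[of _ "\<lambda>x. \<Sum>v\<in>V'. (s * l v) * x v"] exI[of _ "s * l u * t"] exI[of _ "s * l y"]) auto
    qed
    have lin: "(\<lambda>x. \<alpha> * f x + \<beta> * g x) \<in> F" if fg: "f \<in> F" "g \<in> F" for f g \<alpha> \<beta>
    proof -
      obtain l m where "f = (\<lambda>x. \<Sum>v\<in>V'. l v * x v)" "g = (\<lambda>x. \<Sum>v\<in>V'. m v * x v)"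
        using fg by (auto simp: F_def)
      then have "(\<lambda>x. \<alpha> * f x + \<beta> * g x) = (\<lambda>x. \<Sum>v\<in>V'. (\<alpha> * l v + \<beta> * m v) * x v)"
        by (simp add: sum_distrib_left sum.distrib algebra_simps)
      then show ?thesis unfolding F_def by (intro range_eqI[of _ _ "\<lambda>v. \<alpha> * l v + \<beta> * m v"]) simp
    qed
    have "c' j > 0" for j using pos \<open>t > 0\<close> by (simp add: c'_def C_def)
    from glue[OF lin this Q] obtain L \<xi> \<kappa> where L: "L \<in> F" and le: "\<And>x p q.
       (\<Sum>k\<le>r. a k x) + 2 * p * (\<Sum>j\<le>r. b (j + 1) x) + 2 * q * b 0 x
         + (\<Sum>j\<le>r. c' (j + 2)) * p\<^sup>2 + 2 * c' 1 * p * q + (c' 0 - c' 1) * q\<^sup>2 \<le> (L x + \<xi> * p + \<kappa> * q)\<^sup>2"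
      by metis
    obtain l where l: "L = (\<lambda>x. \<Sum>v\<in>V'. l v * x v)" using L by (auto simp: F_def)
    \<comment> \<open>Both \<open>p\<close> and \<open>q\<close> become \<open>x y\<close>, so their
      coefficients add up.\<close>
    define l' where "l' = l(y := \<xi> + \<kappa>)"
    define T where "T = (\<lambda>v w. transfer_mass u y t c (add_mset v (add_mset w \<mu>)))"
    have symT: "T v w = T w v" for v w by (simp add: T_def add_mset_commute)
    \<comment> \<open>The number of movable copies of \<open>y\<close> is r, r + 1 or r + 2,
      according to how many of the two indices are \<open>y\<close>.\<close>
    have T1: "T v w = (\<Sum>k\<le>r. C k r {#v, w#})" if "v \<in> V'" "w \<in> V'" for v w
    proof -
      have "v \<noteq> y" "w \<noteq> y" using that V'(2) by auto
      then have "y \<notin># add_mset v (add_mset w \<nu>)" using \<nu>(1) by auto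
      from transfer_mass_eval[OF this, of u t c r] show ?thesis by (simp add: T_def C_def \<nu>(2))
    qed
    have T2: "T y v = (\<Sum>k\<le>r + 1. C k (r + 1) {#v#})" if "v \<in> V'" for v
    proof -
      have "v \<noteq> y" using that V'(2) by auto
      then have "y \<notin># add_mset v \<nu>" using \<nu>(1) by auto
      from transfer_mass_eval[OF this, of u t c "r + 1"] show ?thesis
        by (simp add: T_def C_def \<nu>(2) add_mset_commute del: sum.atMost_Suc)
    qed
    have T3: "T y y = (\<Sum>k\<le>r + 2. c' k)"
      using transfer_mass_eval[OF \<nu>(1), of u t c "r + 2"]
      by (simp add: T_def c'_def C_def \<nu>(2) del: sum.atMost_Suc)
    have "quad T V x \<le> (\<Sum>v\<in>V. l' v * x v)\<^sup>2" for x
    proof -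
      have "quad T V' x = (\<Sum>k\<le>r. a k x)"
      proof -
        have "quad T V' x = quad (\<lambda>v w. \<Sum>k\<le>r. C k r {#v, w#}) V' x"
          by (intro quad_cong) (auto simp: T1)
        also have "\<dots> = (\<Sum>v\<in>V'. \<Sum>k\<le>r. \<Sum>w\<in>V'. x v * x w * C k r {#v, w#})"
          unfolding quad_def sum_distrib_left by (intro sum.cong refl sum.swap)
        also have "\<dots> = (\<Sum>k\<le>r. a k x)"
          unfolding a_def quad_def by (rule sum.swap)
        finally show ?thesis .
      qed
      moreover have "(\<Sum>v\<in>V'. x v * T y v) = (\<Sum>j\<le>r. b (j + 1) x) + b 0 x"
      proof -
        have "(\<Sum>v\<in>V'. x v * T y v) = (\<Sum>v\<in>V'. \<Sum>k\<le>r + 1. x v * C k (r + 1) {#v#})"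
          by (simp add: T2 sum_distrib_left cong: sum.cong del: sum.atMost_Suc)
        also have "\<dots> = (\<Sum>k\<le>Suc r. b k x)"
          unfolding b_def by (subst sum.swap) simp
        finally show ?thesis by (simp only: sum.atMost_Suc_shift) (simp add: add.commute)
      qed
      \<comment> \<open>At \<open>p = q\<close>, the cross term \<open>2 * c' 1\<close> and the
        \<open>- c' 1\<close> in the coefficient of the square of \<open>q\<close> leave
        \<open>c' 1\<close> once, as required here.\<close>
      moreover have "T y y = (\<Sum>j\<le>r. c' (j + 2)) + c' 1 + c' 0"
        unfolding T3 by (simp only: add_2_eq_Suc' sum.atMost_Suc_shift) (simp add: numeral_2_eq_2 add.assoc)
      ultimately have "quad T V x = (\<Sum>k\<le>r. a k x) + 2 * x y * (\<Sum>j\<le>r. b (j + 1) x) + 2 * x y * b 0 x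
         + (\<Sum>j\<le>r. c' (j + 2)) * (x y)\<^sup>2 + 2 * c' 1 * x y * x y + (c' 0 - c' 1) * (x y)\<^sup>2"
        unfolding V'(1) quad_insert[OF V'(3,2) symT]
        by (simp add: power2_eq_square algebra_simps)
      also have "\<dots> \<le> (L x + \<xi> * x y + \<kappa> * x y)\<^sup>2" by (rule le)
      also have "L x + \<xi> * x y + \<kappa> * x y = (\<Sum>v\<in>V. l' v * x v)"
      proof -
        have "(\<Sum>v\<in>V'. l' v * x v) = L x" unfolding l using V'(2) by (intro sum.cong) (auto simp: l'_def)
        then show ?thesis using V' by (simp add: l'_def algebra_simps)
      qed
      finally show ?thesis .
    qed
    then show ?thesis unfolding T_def by blast
  qed
  moreover have "transfer_mass u y t c \<mu> > 0" for \<mu>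
    unfolding transfer_mass_def using pos \<open>t > 0\<close> by (intro sum_pos) auto
  ultimately show ?thesis by (simp add: lorentzian_def)
qed

section \<open>Log-concavity from, and examples of, Lorentzian arrays\<close>

lemma quad_zero: "quad M V (\<lambda>_. 0) = 0"
  by (simp add: quad_def)

text \<open>On the plane spanned by the coordinates \<open>u\<close> and \<open>v\<close>, a form
  with at most one positive eigenvalue and a positive diagonal entry has nonpositive
  determinant.\<close>

lemma lorentzian_log_concave:
  assumes c: "lorentzian V c" and V: "finite V" "u \<in> V" "v \<in> V" "u \<noteq> v"
  shows "c (add_mset u (add_mset u \<mu>)) * c (add_mset v (add_mset v \<mu>)) \<le> (c (add_mset u (add_mset v \<mu>)))\<^sup>2"
proof -
  define M where "M = (\<lambda>a b. c (add_mset a (add_mset b \<mu>)))"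
  have sym: "M a b = M b a" for a b by (simp add: M_def add_mset_commute)
  obtain l where l: "\<And>x. quad M V x \<le> (\<Sum>v\<in>V. l v * x v)\<^sup>2"
    using c unfolding lorentzian_def M_def by blast
  have "M u u > 0" using c by (simp add: M_def lorentzian_def)
  have le: "M u u * p\<^sup>2 + 2 * M u v * p * q + M v v * q\<^sup>2 \<le> (l u * p + l v * q)\<^sup>2" for p q
  proof -
    define x0 :: "'a \<Rightarrow> real" where "x0 = (\<lambda>_. 0)"
    define x1 where "x1 = x0(u := x0 u + p)"
    define x2 where "x2 = x1(v := x1 v + q)"
    have x1: "x1 w = (if w = u then p else 0)" for w by (simp add: x1_def x0_def)
    have x2: "x2 w = (if w = u then p else 0) + (if w = v then q else 0)" for w
      using V(4) by (simp add: x2_def x1)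
    have "quad M V x2 = quad M V x1 + 2 * q * (\<Sum>w\<in>V. x1 w * M v w) + q\<^sup>2 * M v v"
      unfolding x2_def by (rule quad_upd[OF V(1,3) sym])
    also have "quad M V x1 = quad M V x0 + 2 * p * (\<Sum>w\<in>V. x0 w * M u w) + p\<^sup>2 * M u u"
      unfolding x1_def by (rule quad_upd[OF V(1,2) sym])
    also have "(\<Sum>w\<in>V. x1 w * M v w) = p * M v u"
      using V by (simp add: x1 if_distrib[of "\<lambda>x. x * _"] cong: if_cong)
    finally have "quad M V x2 = M u u * p\<^sup>2 + 2 * M u v * p * q + M v v * q\<^sup>2"
      by (simp add: x0_def quad_zero sym[of v u])
    moreover have "(\<Sum>w\<in>V. l w * x2 w) = l u * p + l v * q"
      using V by (simp add: x2 distrib_left sum.distrib if_distrib[of "\<lambda>x. _ * x"] cong: if_cong)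
    ultimately show ?thesis using l[of x2] by simp
  qed
  have "l u \<noteq> 0" using le[of 1 0] \<open>M u u > 0\<close> by auto
  \<comment> \<open>The bounding linear form vanishes at \<open>(- l v, l u)\<close>; multiplying by
    \<open>M u u\<close> allows completing the square, which isolates the determinant.\<close>
  have "M u u * (M u u * (l v)\<^sup>2 - 2 * M u v * l u * l v + M v v * (l u)\<^sup>2) \<le> M u u * 0"
    using le[of "- l v" "l u"] \<open>M u u > 0\<close> by (intro mult_left_mono) (auto simp: algebra_simps)
  moreover have "M u u * (M u u * (l v)\<^sup>2 - 2 * M u v * l u * l v + M v v * (l u)\<^sup>2)
      = (M u u * l v - M u v * l u)\<^sup>2 + (M u u * M v v - (M u v)\<^sup>2) * (l u)\<^sup>2"
    by (simp add: power2_eq_square algebra_simps)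
  ultimately have "(M u u * M v v - (M u v)\<^sup>2) * (l u)\<^sup>2 \<le> 0"
    using zero_le_power2[of "M u u * l v - M u v * l u"] by linarith
  then have "M u u * M v v - (M u v)\<^sup>2 \<le> 0"
    using \<open>l u \<noteq> 0\<close> by (simp add: mult_le_0_iff)
  then show ?thesis by (simp add: M_def)
qed

text \<open>Off the diagonal the matrix agrees with the rank-one matrix
  \<open>c \<mu> * \<rho> a * \<rho> b\<close>, and log-concavity says that its diagonal is no
  larger. Hence the form lies below the square of one linear form.\<close>

lemma lorentzian_separable:
  assumes "finite V" and pos: "\<And>v n. \<phi> v n > (0::real)"
    and lc: "\<And>v n. \<phi> v n * \<phi> v (n + 2) \<le> (\<phi> v (n + 1))\<^sup>2"
  shows "lorentzian V (\<lambda>\<mu>. \<Prod>v\<in>V. \<phi> v (count \<mu> v))"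
proof -
  define c where "c = (\<lambda>\<mu>. \<Prod>v\<in>V. \<phi> v (count \<mu> v))"
  have cpos: "c \<mu> > 0" for \<mu> unfolding c_def using pos by (intro prod_pos) auto
  have add: "c (add_mset a \<mu>) = c \<mu> * (\<phi> a (count \<mu> a + 1) / \<phi> a (count \<mu> a))" if "a \<in> V" for a \<mu>
  proof -
    have "(\<Prod>v\<in>V - {a}. \<phi> v (count (add_mset a \<mu>) v)) = (\<Prod>v\<in>V - {a}. \<phi> v (count \<mu> v))"
      by (intro prod.cong) auto
    then show ?thesis using that \<open>finite V\<close> pos[of a "count \<mu> a"]
      by (simp add: c_def prod.remove)
  qed
  have "\<exists>l. \<forall>x. quad (\<lambda>a b. c (add_mset a (add_mset b \<mu>))) V x \<le> (\<Sum>v\<in>V. l v * x v)\<^sup>2" for \<mu>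
  proof -
    define \<rho> where "\<rho> = (\<lambda>a. \<phi> a (count \<mu> a + 1) / \<phi> a (count \<mu> a))"
    \<comment> \<open>The sign of \<open>x a * x b\<close> is unknown only off the diagonal, where
      equality holds.\<close>
    have entry: "x a * x b * c (add_mset a (add_mset b \<mu>)) \<le> x a * x b * (c \<mu> * \<rho> a * \<rho> b)"
      if "a \<in> V" "b \<in> V" for a b x
    proof (cases "a = b")
      case True
      let ?n = "count \<mu> a"
      have "\<phi> a (?n + 2) / \<phi> a (?n + 1) \<le> \<rho> a"
        using lc[of a ?n] pos[of a ?n] pos[of a "?n + 1"]
        by (simp add: \<rho>_def field_simps power2_eq_square)
      moreover have "\<rho> a > 0" using pos by (simp add: \<rho>_def)
      ultimately have "c \<mu> * \<rho> a * (\<phi> a (?n + 2) / \<phi> a (?n + 1)) \<le> c \<mu> * \<rho> a * \<rho> a"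
        using cpos[of \<mu>] by (intro mult_left_mono) auto
      then have "c (add_mset a (add_mset b \<mu>)) \<le> c \<mu> * \<rho> a * \<rho> b"
        using that True by (simp add: add \<rho>_def)
      then show ?thesis using True by (intro mult_left_mono) auto
    next
      case False
      then show ?thesis using that by (simp add: add \<rho>_def mult_ac)
    qed
    have "quad (\<lambda>a b. c (add_mset a (add_mset b \<mu>))) V x \<le> (\<Sum>v\<in>V. (sqrt (c \<mu>) * \<rho> v) * x v)\<^sup>2" for x
    proof -
      have "quad (\<lambda>a b. c (add_mset a (add_mset b \<mu>))) V x
          \<le> (\<Sum>a\<in>V. \<Sum>b\<in>V. x a * x b * (c \<mu> * \<rho> a * \<rho> b))"
        unfolding quad_def by (intro sum_mono entry)
      also have "\<dots> = (\<Sum>a\<in>V. \<Sum>b\<in>V. ((sqrt (c \<mu>) * \<rho> a) * x a) * ((sqrt (c \<mu>) * \<rho> b) * x b))"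
      proof -
        have "sqrt (c \<mu>) * sqrt (c \<mu>) = c \<mu>" using cpos[of \<mu>] by simp
        then have "x a * x b * (c \<mu> * \<rho> a * \<rho> b)
            = ((sqrt (c \<mu>) * \<rho> a) * x a) * ((sqrt (c \<mu>) * \<rho> b) * x b)" for a b
          by (metis (no_types, opaque_lifting) mult.assoc mult.commute)
        then show ?thesis by (simp only:)
      qed
      finally show ?thesis by (simp add: power2_eq_square sum_product)
    qed
    then show ?thesis by (intro exI[of _ "\<lambda>v. sqrt (c \<mu>) * \<rho> v"]) simp
  qed
  then show ?thesis unfolding lorentzian_def using cpos by (simp add: c_def)
qed

section \<open>Many transfers at once: sums over edge configurations\<close>

definition edge_mset :: "('e \<Rightarrow> 'v) \<Rightarrow> 'e set \<Rightarrow> ('e \<Rightarrow> nat) \<Rightarrow> 'v multiset" where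
  "edge_mset \<tau> E a = (\<Sum>e\<in>E. replicate_mset (a e) (\<tau> e))"

lemma count_edge_mset: "finite E \<Longrightarrow> count (edge_mset \<tau> E a) v = (\<Sum>e\<in>{e\<in>E. \<tau> e = v}. a e)"
  by (simp add: edge_mset_def count_sum sum.If_cases Int_def) (auto intro!: sum.cong)

definition flow_configs :: "('e \<Rightarrow> 'v) \<Rightarrow> 'e set \<Rightarrow> 'v multiset \<Rightarrow> ('e \<Rightarrow> nat) set" where
  "flow_configs \<tau> E \<mu> = {a \<in> E \<rightarrow>\<^sub>E UNIV. edge_mset \<tau> E a \<subseteq># \<mu>}"

text \<open>Closed form of one \<open>transfer_mass\<close> per edge: \<open>a e\<close> units leave
  \<tau> e and arrive at \<open>s e\<close>. For tables, \<tau> e is the column of the cell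
  \<open>e\<close>, \<open>s e\<close> its row, and \<open>a\<close> is the table itself.\<close>

definition flow_sum ::
  "('e \<Rightarrow> 'v) \<Rightarrow> ('e \<Rightarrow> 'v) \<Rightarrow> ('e \<Rightarrow> real) \<Rightarrow> ('v multiset \<Rightarrow> real) \<Rightarrow> 'e set \<Rightarrow> 'v multiset \<Rightarrow> real" where
  "flow_sum s \<tau> t c E \<mu> =
     (\<Sum>a\<in>flow_configs \<tau> E \<mu>. (\<Prod>e\<in>E. t e ^ a e) * c (\<mu> - edge_mset \<tau> E a + edge_mset s E a))"

lemma finite_flow_configs:
  assumes "finite E"
  shows "finite (flow_configs \<tau> E \<mu>)"
proof (rule finite_subset)
  show "flow_configs \<tau> E \<mu> \<subseteq> E \<rightarrow>\<^sub>E {..size \<mu>}"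
  proof
    fix a assume a: "a \<in> flow_configs \<tau> E \<mu>"
    have "a e \<le> size \<mu>" if "e \<in> E" for e
    proof -
      have "a e \<le> (\<Sum>e'\<in>{e'\<in>E. \<tau> e' = \<tau> e}. a e')"
        using assms that by (intro member_le_sum) auto
      also have "\<dots> \<le> count \<mu> (\<tau> e)"
        using a assms by (auto simp: flow_configs_def subseteq_mset_def count_edge_mset)
      finally show ?thesis using count_le_size[of \<mu> "\<tau> e"] by linarith
    qed
    then show "a \<in> E \<rightarrow>\<^sub>E {..size \<mu>}" using a by (auto simp: flow_configs_def PiE_iff)
  qed
qed (use assms in \<open>auto intro: finite_PiE\<close>)

lemma flow_sum_empty: "flow_sum s \<tau> t c {} = c"
  by (rule ext) (simp add: flow_sum_def flow_configs_def edge_mset_def)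

text \<open>No edge takes units away from \<open>s e\<close>, so units that arrive there are never
  moved on. The value k on the new edge can therefore be fixed first, and the other edges see the
  multiset left after these k moves.\<close>

lemma flow_sum_insert:
  assumes E: "finite E" "e \<notin> E" and st: "\<And>e'. e' \<in> insert e E \<Longrightarrow> \<tau> e' \<noteq> s e"
  shows "flow_sum s \<tau> t c (insert e E) = transfer_mass (s e) (\<tau> e) (t e) (flow_sum s \<tau> t c E)"
proof
  fix \<mu>
  define \<mu>' where "\<mu>' = (\<lambda>k. \<mu> - replicate_mset k (\<tau> e) + replicate_mset k (s e))"
  have in0: "count (edge_mset \<tau> E a) (s e) = 0" for a
    using st E(1) by (auto simp: count_edge_mset)
  have ins: "edge_mset f (insert e E) b = replicate_mset (b e) (f e) + edge_mset f E b" for f and b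
    using E by (simp add: edge_mset_def)
  have upd: "edge_mset f E (a(e := k)) = edge_mset f E a" for f :: "'a \<Rightarrow> 'b" and a k
    unfolding edge_mset_def using E(2) by (intro sum.cong) auto
  have sub: "replicate_mset k (\<tau> e) + edge_mset \<tau> E a \<subseteq># \<mu> \<longleftrightarrow>
      k \<le> count \<mu> (\<tau> e) \<and> edge_mset \<tau> E a \<subseteq># \<mu>' k" for k a
  proof -
    have c: "count (\<mu>' k) v = count \<mu> v - (if v = \<tau> e then k else 0) + (if v = s e then k else 0)" for v
      by (simp add: \<mu>'_def)
    have c': "count (replicate_mset k (\<tau> e) + edge_mset \<tau> E a) v
        = (if v = \<tau> e then k else 0) + count (edge_mset \<tau> E a) v" for v by simp
    show ?thesis
    proof
      assume l: "replicate_mset k (\<tau> e) + edge_mset \<tau> E a \<subseteq># \<mu>"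
      then have l: "(if v = \<tau> e then k else 0) + count (edge_mset \<tau> E a) v \<le> count \<mu> v" for v
        using mset_subset_eq_count[OF l, of v] by simp
      have "count (edge_mset \<tau> E a) v \<le> count (\<mu>' k) v" for v
        using l[of v] unfolding c by (cases "v = \<tau> e") simp_all
      moreover have "k \<le> count \<mu> (\<tau> e)" using l[of "\<tau> e"] by simp
      ultimately show "k \<le> count \<mu> (\<tau> e) \<and> edge_mset \<tau> E a \<subseteq># \<mu>' k"
        by (simp add: subseteq_mset_def)
    next
      assume r: "k \<le> count \<mu> (\<tau> e) \<and> edge_mset \<tau> E a \<subseteq># \<mu>' k"
      have le: "count (edge_mset \<tau> E a) v \<le> count (\<mu>' k) v" for v
        using mset_subset_eq_count[OF r[THEN conjunct2], of v] .
      have "\<tau> e \<noteq> s e" using st[of e] by simp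
      then have "(if v = \<tau> e then k else 0) + count (edge_mset \<tau> E a) v \<le> count \<mu> v" for v
        using r[THEN conjunct1] in0[of a] le[of v] unfolding c
        by (cases "v = \<tau> e"; cases "v = s e") simp_all
      then show "replicate_mset k (\<tau> e) + edge_mset \<tau> E a \<subseteq># \<mu>"
        unfolding subseteq_mset_def c' by blast
    qed
  qed
  have arg: "\<mu> - (replicate_mset k (\<tau> e) + edge_mset \<tau> E a) + (replicate_mset k (s e) + edge_mset s E a)
      = \<mu>' k - edge_mset \<tau> E a + edge_mset s E a" for k a
    using in0[of a] st[of e] by (auto simp: multiset_eq_iff \<mu>'_def)
  have "transfer_mass (s e) (\<tau> e) (t e) (flow_sum s \<tau> t c E) \<mu> =
     (\<Sum>k\<le>count \<mu> (\<tau> e). \<Sum>a\<in>flow_configs \<tau> E (\<mu>' k).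
       t e ^ k * ((\<Prod>e\<in>E. t e ^ a e) * c (\<mu>' k - edge_mset \<tau> E a + edge_mset s E a)))"
    by (simp add: transfer_mass_def flow_sum_def sum_distrib_left \<mu>'_def)
  also have "\<dots> = (\<Sum>(k, a)\<in>Sigma {..count \<mu> (\<tau> e)} (\<lambda>k. flow_configs \<tau> E (\<mu>' k)).
       t e ^ k * ((\<Prod>e\<in>E. t e ^ a e) * c (\<mu>' k - edge_mset \<tau> E a + edge_mset s E a)))"
    using E(1) by (intro sum.Sigma) (auto intro: finite_flow_configs)
  also have "\<dots> = flow_sum s \<tau> t c (insert e E) \<mu>"
  proof -
    \<comment> \<open>Resetting the value at \<open>e\<close> to \<open>undefined\<close> turns an
      extensional function on \<open>insert e E\<close> into one on \<open>E\<close>.\<close>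
    have 1: "((a(e := k)) e, (a(e := k))(e := undefined)) = (k, a)"
      if "a \<in> flow_configs \<tau> E (\<mu>' k)" for k a
      using that E(2) by (auto simp: flow_configs_def PiE_def extensional_def fun_eq_iff)
    have 2: "a(e := k) \<in> flow_configs \<tau> (insert e E) \<mu>"
      if "k \<le> count \<mu> (\<tau> e)" "a \<in> flow_configs \<tau> E (\<mu>' k)" for k a
      using that sub[of k a] by (auto simp: flow_configs_def ins upd PiE_iff extensional_def)
    have 3: "(\<Prod>e'\<in>insert e E. t e' ^ (a(e := k)) e') *
         c (\<mu> - edge_mset \<tau> (insert e E) (a(e := k)) + edge_mset s (insert e E) (a(e := k))) =
       t e ^ k * ((\<Prod>e\<in>E. t e ^ a e) * c (\<mu>' k - edge_mset \<tau> E a + edge_mset s E a))" for k a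
    proof -
      have "(\<Prod>e'\<in>E. t e' ^ (a(e := k)) e') = (\<Prod>e\<in>E. t e ^ a e)"
        using E(2) by (intro prod.cong) auto
      then show ?thesis using E by (simp add: ins upd arg)
    qed
    have 4: "b e \<le> count \<mu> (\<tau> e)" "b(e := undefined) \<in> flow_configs \<tau> E (\<mu>' (b e))"
      if "b \<in> flow_configs \<tau> (insert e E) \<mu>" for b
      using that sub[of "b e" b] E(2) by (auto simp: flow_configs_def ins upd PiE_iff extensional_def)
    show ?thesis
      unfolding flow_sum_def
      by (rule sum.reindex_bij_witness[of _ "\<lambda>b. (b e, b(e := undefined))" "\<lambda>(k, a). a(e := k)"])
         (use 1 2 3 4 in \<open>auto simp del: fun_upd_apply simp: fun_upd_same\<close>)
  qed
  finally show "flow_sum s \<tau> t c (insert e E) \<mu> = transfer_mass (s e) (\<tau> e) (t e) (flow_sum s \<tau> t c E) \<mu>"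
    by simp
qed

lemma lorentzian_flow_sum:
  assumes c: "lorentzian V c" and V: "finite V" and "finite E"
    and st: "\<And>e. e \<in> E \<Longrightarrow> s e \<in> V \<and> \<tau> e \<in> V \<and> t e > 0"
    and disj: "\<And>e e'. e \<in> E \<Longrightarrow> e' \<in> E \<Longrightarrow> \<tau> e' \<noteq> s e"
  shows "lorentzian V (flow_sum s \<tau> t c E)"
  using \<open>finite E\<close> st disj
proof (induction E)
  case empty
  then show ?case using c by (simp add: flow_sum_empty)
next
  case (insert e E)
  have "lorentzian V (transfer_mass (s e) (\<tau> e) (t e) (flow_sum s \<tau> t c E))"
    using insert.prems V by (intro lorentzian_transfer_mass insert.IH) (auto simp: eq_commute[of "s e"])
  then show ?case using insert by (subst flow_sum_insert) auto
qed

subsection \<open>Extracting one column\<close>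

text \<open>The maximum of \<open>q ^ k * (1 - q)\<close> on the unit interval, attained at
  \<open>q = k / (k + 1)\<close>. The value at k = 0 is 1, since \<open>0 ^ 0 = 1\<close>.\<close>

definition cap_factor :: "nat \<Rightarrow> real" where
  "cap_factor k = real k ^ k / real (k + 1) ^ (k + 1)"

lemma cap_factor_pos: "cap_factor k > 0"
  by (cases k) (simp_all add: cap_factor_def)

text \<open>The point \<open>x\<close> minimises the geometric majorant \<open>c k * r powi (j - k)\<close>, summed against \<open>x ^ (j - k)\<close>,
  where \<open>r = c k / c (k - 1)\<close>; it does not depend on \<open>N\<close>.\<close>

lemma log_concave_sum_le:
  fixes c :: "nat \<Rightarrow> real"
  assumes pos: "\<And>j. c j > 0" and lc: "\<And>j. j + 2 \<le> N \<Longrightarrow> c j * c (j + 2) \<le> (c (j + 1))\<^sup>2"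
    and k: "1 \<le> k" "k \<le> N" and x: "x = real k / real (k + 1) * (c (k - 1) / c k)"
  shows "cap_factor k * (\<Sum>j\<le>N. c j * x ^ j) \<le> c k * x ^ k"
proof -
  define \<rho> where "\<rho> = (\<lambda>j. c (j + 1) / c j)"
  have \<rho>pos: "\<rho> j > 0" for j using pos by (simp add: \<rho>_def)
  have desc: "Suc j < N \<longrightarrow> \<rho> (Suc j) \<le> \<rho> j" for j
    using lc[of j] pos[of j] pos[of "Suc j"] by (auto simp: \<rho>_def field_simps power2_eq_square)
  \<comment> \<open>Log-concavity is assumed only up to index \<open>N\<close>, so the ratios are
    compared only below \<open>N\<close>.\<close>
  have anti: "i \<le> j \<Longrightarrow> j < N \<Longrightarrow> \<rho> j \<le> \<rho> i" for i j
  proof (induction j rule: dec_induct)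
    case (step j)
    then show ?case using desc[of j] by simp
  qed simp
  define r where "r = \<rho> (k - 1)"
  have r: "r > 0" by (simp add: r_def \<rho>pos)
  have up: "c (k + d) \<le> c k * r ^ d" if "k + d \<le> N" for d
    using that
  proof (induction d)
    case (Suc d)
    have "c (k + Suc d) = c (k + d) * \<rho> (k + d)" using pos[of "k + d"] by (simp add: \<rho>_def)
    also have "\<dots> \<le> (c k * r ^ d) * r"
      using Suc anti[of "k - 1" "k + d"] pos \<rho>pos r
      by (intro mult_mono) (auto simp: r_def intro!: less_imp_le)
    finally show ?case by (simp add: mult_ac)
  qed simp
  have down: "c (k - d) * r ^ d \<le> c k" if "d \<le> k" for d
    using that
  proof (induction d)
    case (Suc d)
    have e: "k - Suc d + 1 = k - d" using Suc.prems by simp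
    have "c (k - Suc d) * r \<le> c (k - Suc d) * \<rho> (k - Suc d)"
      using anti[of "k - Suc d" "k - 1"] pos[of "k - Suc d"] k Suc.prems
      by (intro mult_left_mono) (auto simp: r_def intro!: less_imp_le)
    also have "\<dots> = c (k - d)" using pos[of "k - Suc d"] unfolding \<rho>_def e by simp
    finally have "c (k - Suc d) * r * r ^ d \<le> c (k - d) * r ^ d" using r by (intro mult_right_mono) auto
    then show ?case using Suc by (simp add: mult_ac)
  qed simp
  \<comment> \<open>This is the geometric majorant through \<open>c (k - 1)\<close> and
    \<open>c k\<close>, multiplied by \<open>r ^ k\<close> so that indices on both sides of k obey
    one inequality without negative powers.\<close>
  have main: "c j * r ^ k \<le> c k * r ^ j" if "j \<le> N" for j
  proof (cases "k \<le> j")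
    case True
    then have "c j * r ^ k \<le> c k * r ^ (j - k) * r ^ k"
      using up[of "j - k"] that r by (intro mult_right_mono) auto
    then show ?thesis using True by (simp add: mult.assoc flip: power_add)
  next
    case False
    then have "c j * r ^ (k - j) * r ^ j \<le> c k * r ^ j"
      using down[of "k - j"] r by (intro mult_right_mono) auto
    then show ?thesis using False by (simp add: mult.assoc flip: power_add)
  qed
  \<comment> \<open>The majorant becomes a geometric series in \<open>q = r * x\<close>, taken at
    the point where \<open>q ^ k * (1 - q)\<close> is largest.\<close>
  define q where "q = real k / real (k + 1)"
  have q: "0 < q" "q < 1" using k by (simp_all add: q_def)
  have "r = c k / c (k - 1)" using k by (simp add: r_def \<rho>_def)
  then have x: "x = q / r" by (simp add: x q_def)
  have "r ^ k * (\<Sum>j\<le>N. c j * x ^ j) = (\<Sum>j\<le>N. (c j * r ^ k) * x ^ j)"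
    by (simp add: sum_distrib_left mult_ac)
  also have "\<dots> \<le> (\<Sum>j\<le>N. (c k * r ^ j) * x ^ j)"
    using main q r by (intro sum_mono mult_right_mono) (auto simp: x)
  also have "\<dots> = c k * (\<Sum>j\<le>N. q ^ j)"
    using r by (simp add: x sum_distrib_left power_divide)
  also have "\<dots> \<le> c k * (1 / (1 - q))"
  proof -
    have "(\<Sum>j\<le>N. q ^ j) = (1 - q ^ Suc N) / (1 - q)" using q by (simp add: sum_gp0)
    also have "\<dots> \<le> 1 / (1 - q)" using q by (intro divide_right_mono) auto
    finally show ?thesis using pos[of k] by (intro mult_left_mono) auto
  qed
  also have "1 / (1 - q) = real (k + 1)" by (simp add: q_def field_simps)
  finally have "cap_factor k * (r ^ k * (\<Sum>j\<le>N. c j * x ^ j)) \<le> cap_factor k * (c k * real (k + 1))"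
    using cap_factor_pos[of k] by (intro mult_left_mono) auto
  also have "\<dots> = c k * q ^ k"
  proof -
    have "cap_factor k * real (k + 1) = q ^ k"
      unfolding cap_factor_def q_def power_divide power_add power_one_right by simp
    then show ?thesis by (simp add: mult_ac)
  qed
  also have "\<dots> = r ^ k * (c k * x ^ k)" using r by (simp add: x power_divide)
  finally have "r ^ k * (cap_factor k * (\<Sum>j\<le>N. c j * x ^ j)) \<le> r ^ k * (c k * x ^ k)"
    by (simp add: mult_ac)
  then show ?thesis using r by simp
qed

section \<open>Tables with prescribed margins, extracted column by column\<close>

definition tables ::
  "('a \<times> 'b) set \<Rightarrow> 'a set \<Rightarrow> ('a \<Rightarrow> nat) \<Rightarrow> 'b set \<Rightarrow> ('b \<Rightarrow> nat) \<Rightarrow> ('a \<times> 'b \<Rightarrow> nat) set" where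
  "tables E R \<alpha> K \<beta> = {a \<in> E \<rightarrow>\<^sub>E UNIV.
     (\<forall>i\<in>R. (\<Sum>e\<in>{e\<in>E. fst e = i}. a e) = \<alpha> i) \<and> (\<forall>j\<in>K. (\<Sum>e\<in>{e\<in>E. snd e = j}. a e) = \<beta> j)}"

text \<open>A partly extracted generating function: the row variables are extracted at \<alpha> and
  the column variables in \<open>K\<close> at \<beta>, while the other column variables still have
  the values \<open>y\<close>. Once \<open>K\<close> contains every column, it counts
  tables.\<close>

definition table_weight ::
  "('a \<times> 'b) set \<Rightarrow> 'a set \<Rightarrow> ('a \<Rightarrow> nat) \<Rightarrow> 'b set \<Rightarrow> ('b \<Rightarrow> nat) \<Rightarrow> ('b \<Rightarrow> real) \<Rightarrow> real" where
  "table_weight E R \<alpha> K \<beta> y = (\<Sum>a\<in>tables E R \<alpha> K \<beta>. \<Prod>e\<in>{e\<in>E. snd e \<notin> K}. y (snd e) ^ a e)"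

lemma tables_total:
  assumes "finite E" "finite R" "fst ` E \<subseteq> R" "a \<in> tables E R \<alpha> K \<beta>"
  shows "sum a E = sum \<alpha> R"
proof -
  have "sum a E = (\<Sum>i\<in>R. \<Sum>e\<in>{e\<in>E. fst e = i}. a e)"
    using assms(1-3) by (rule sum.group[symmetric])
  also have "\<dots> = sum \<alpha> R" using assms(4) by (simp add: tables_def)
  finally show ?thesis .
qed

lemma finite_tables:
  assumes "finite E" "finite R" "fst ` E \<subseteq> R"
  shows "finite (tables E R \<alpha> K \<beta>)"
proof (rule finite_subset)
  show "tables E R \<alpha> K \<beta> \<subseteq> E \<rightarrow>\<^sub>E {..sum \<alpha> R}"
  proof
    fix a assume a: "a \<in> tables E R \<alpha> K \<beta>"
    have "a e \<le> sum \<alpha> R" if "e \<in> E" for e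
      using member_le_sum[of e E a] that \<open>finite E\<close> tables_total[OF assms a] by simp
    then show "a \<in> E \<rightarrow>\<^sub>E {..sum \<alpha> R}" using a by (auto simp: tables_def PiE_iff)
  qed
qed (use assms in \<open>auto intro: finite_PiE\<close>)

lemma sum_split_columns:
  fixes a :: "'a \<times> 'b \<Rightarrow> nat"
  assumes "finite E" "finite K"
  shows "sum a E = (\<Sum>j\<in>K. \<Sum>e\<in>{e\<in>E. snd e = j}. a e) + (\<Sum>e\<in>{e\<in>E. snd e \<notin> K}. a e)"
proof -
  have "sum a E = sum a {e\<in>E. snd e \<in> K} + sum a {e\<in>E. snd e \<notin> K}"
    using assms(1) by (subst sum.union_disjoint[symmetric]) (auto intro: sum.cong)
  also have "sum a {e\<in>E. snd e \<in> K} = (\<Sum>j\<in>K. \<Sum>e\<in>{e\<in>{e\<in>E. snd e \<in> K}. snd e = j}. a e)"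
    using assms by (intro sum.group[symmetric]) auto
  also have "\<dots> = (\<Sum>j\<in>K. \<Sum>e\<in>{e\<in>E. snd e = j}. a e)"
    by (intro sum.cong refl) auto
  finally show ?thesis .
qed

text \<open>All columns outside \<open>insert m J\<close> are merged into one sink vertex \<open>Inr None\<close>.  The initial array
  \<open>\<epsilon> ^ dev\<close> is positive everywhere, and for \<open>\<epsilon> \<rightarrow> 0\<close> it concentrates on row sums \<open>\<alpha>\<close> and empty columns.\<close>

lemma table_weight_log_concave_approx:
  fixes E :: "('a \<times> 'b) set" and y :: "'b \<Rightarrow> real"
  assumes E: "finite E" and R: "finite R" "fst ` E \<subseteq> R" and J: "finite J" "m \<notin> J"
    and y: "\<And>j. y j > 0" and N: "sum \<alpha> R = sum \<beta> J + N"
  obtains w :: "real \<Rightarrow> nat \<Rightarrow> real" where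
    "\<And>\<epsilon> k. 0 < \<epsilon> \<Longrightarrow> \<epsilon> \<le> 1 \<Longrightarrow> w \<epsilon> k > 0"
    "\<And>\<epsilon> k. 0 < \<epsilon> \<Longrightarrow> \<epsilon> \<le> 1 \<Longrightarrow> k + 2 \<le> N \<Longrightarrow> w \<epsilon> k * w \<epsilon> (k + 2) \<le> (w \<epsilon> (k + 1))\<^sup>2"
    "\<And>\<epsilon> k. 0 < \<epsilon> \<Longrightarrow> k \<le> N \<Longrightarrow> table_weight E R \<alpha> (insert m J) (\<beta>(m := k)) y \<le> w \<epsilon> k"
    "\<And>k. k \<le> N \<Longrightarrow> ((\<lambda>\<epsilon>. w \<epsilon> k) \<longlongrightarrow> table_weight E R \<alpha> (insert m J) (\<beta>(m := k)) y) (at_right 0)"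
proof -
  define K where "K = insert m J"
  have K: "finite K" "m \<in> K" using J by (simp_all add: K_def)
  define V :: "('a + 'b option) set" where "V = Inl ` R \<union> Inr ` insert None (Some ` K)"
  have V: "finite V" using R K by (simp add: V_def)
  define s :: "'a \<times> 'b \<Rightarrow> 'a + 'b option" where "s = (\<lambda>e. Inl (fst e))"
  define \<tau> :: "'a \<times> 'b \<Rightarrow> 'a + 'b option" where
    "\<tau> = (\<lambda>e. Inr (if snd e \<in> K then Some (snd e) else None))"
  define t where "t = (\<lambda>e :: 'a \<times> 'b. if snd e \<in> K then 1 else y (snd e))"
  \<comment> \<open>On a row vertex the two truncated differences add up to the distance from the
    wanted row sum.\<close>
  define dev :: "'a + 'b option \<Rightarrow> nat \<Rightarrow> nat" where
    "dev = (\<lambda>v n. case v of Inl i \<Rightarrow> (n - \<alpha> i) + (\<alpha> i - n) | Inr _ \<Rightarrow> n)"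
  define c where "c = (\<lambda>\<epsilon> \<mu>. \<Prod>v\<in>V. (\<epsilon> :: real) ^ dev v (count \<mu> v))"
  \<comment> \<open>For k at most \<open>N\<close> the total size is \<open>sum \<alpha> R\<close>,
    so emptying all columns can fill all rows exactly.\<close>
  define \<mu> where "\<mu> = (\<lambda>k. (\<Sum>j\<in>J. replicate_mset (\<beta> j) (Inr (Some j) :: 'a + 'b option))
      + replicate_mset k (Inr (Some m)) + replicate_mset (N - k) (Inr None))"
  define w where "w = (\<lambda>\<epsilon> k. flow_sum s \<tau> t (c \<epsilon>) E (\<mu> k))"
  define \<sigma> where "\<sigma> = (\<lambda>k a. \<mu> k - edge_mset \<tau> E a + edge_mset s E a)"
  define D where "D = (\<lambda>k a. \<Sum>v\<in>V. dev v (count (\<sigma> k a) v))"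
  define P where "P = (\<lambda>a. \<Prod>e\<in>E. t e ^ a e)"
  have tpos: "t e > 0" for e using y by (simp add: t_def)
  have Ppos: "P a > 0" for a unfolding P_def using tpos by (intro prod_pos) auto
  have w: "w \<epsilon> k = (\<Sum>a\<in>flow_configs \<tau> E (\<mu> k). P a * \<epsilon> ^ D k a)" for \<epsilon> k
    by (simp add: w_def flow_sum_def c_def P_def D_def \<sigma>_def power_sum)
  have lor: "lorentzian V (flow_sum s \<tau> t (c \<epsilon>) E)" if "0 < \<epsilon>" "\<epsilon> \<le> 1" for \<epsilon>
  proof (rule lorentzian_flow_sum)
    have "\<epsilon> ^ dev v n * \<epsilon> ^ dev v (n + 2) \<le> (\<epsilon> ^ dev v (n + 1))\<^sup>2" for v n
    proof -
      \<comment> \<open>The exponent is convex in n, and \<epsilon> is at most 1; this is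
        log-concavity of the powers.\<close>
      have "dev v (n + 1) * 2 \<le> dev v n + dev v (n + 2)"
        by (auto simp: dev_def split: sum.splits)
      then show ?thesis using that unfolding power_add[symmetric] power_mult[symmetric]
        by (intro power_decreasing) auto
    qed
    then show "lorentzian V (c \<epsilon>)"
      unfolding c_def using V that by (intro lorentzian_separable) auto
  qed (use V E R K tpos in \<open>auto simp: V_def s_def \<tau>_def\<close>)
  have col: "count (edge_mset \<tau> E a) (Inr (Some j)) = (if j \<in> K then \<Sum>e\<in>{e\<in>E. snd e = j}. a e else 0)"
    "count (edge_mset \<tau> E a) (Inr None) = (\<Sum>e\<in>{e\<in>E. snd e \<notin> K}. a e)"
    "count (edge_mset \<tau> E a) (Inl i) = 0" for a i j
  proof -
    have "{e\<in>E. \<tau> e = Inr (Some j)} = (if j \<in> K then {e\<in>E. snd e = j} else {})"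
      by (auto simp: \<tau>_def)
    then show "count (edge_mset \<tau> E a) (Inr (Some j)) = (if j \<in> K then \<Sum>e\<in>{e\<in>E. snd e = j}. a e else 0)"
      by (simp add: count_edge_mset[OF E])
  qed (auto simp: \<tau>_def count_edge_mset[OF E] intro!: sum.cong)
  have row: "count (edge_mset s E a) (Inl i) = (\<Sum>e\<in>{e\<in>E. fst e = i}. a e)"
    "count (edge_mset s E a) (Inr z) = 0" for a i z
    unfolding count_edge_mset[OF E] by (auto simp: s_def intro!: sum.cong)
  have \<mu>: "count (\<mu> k) (Inr (Some j)) = (if j \<in> K then (\<beta>(m := k)) j else 0)"
    "count (\<mu> k) (Inr None) = N - k" "count (\<mu> k) (Inl i) = 0" for k i j
    using J by (auto simp: \<mu>_def K_def count_sum)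
  \<comment> \<open>Zero deviation means that all columns were emptied and all rows are full, so the
    amounts moved form a table.\<close>
  have tab: "{a \<in> flow_configs \<tau> E (\<mu> k). D k a = 0} = tables E R \<alpha> K (\<beta>(m := k))" (is "?A = ?B") if "k \<le> N" for k
  proof (intro equalityI subsetI)
    fix a assume a: "a \<in> ?A"
    have D0: "dev v (count (\<sigma> k a) v) = 0" if "v \<in> V" for v
      using a that V by (auto simp: D_def)
    have le: "count (edge_mset \<tau> E a) v \<le> count (\<mu> k) v" for v
      using a by (auto simp: flow_configs_def intro: mset_subset_eq_count)
    have "(\<Sum>e\<in>{e\<in>E. fst e = i}. a e) = \<alpha> i" if "i \<in> R" for i
      using D0[of "Inl i"] that by (auto simp: dev_def V_def \<sigma>_def col row \<mu>)
    moreover have "(\<Sum>e\<in>{e\<in>E. snd e = j}. a e) = (\<beta>(m := k)) j" if "j \<in> K" for j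
      using D0[of "Inr (Some j)"] le[of "Inr (Some j)"] that
      by (auto simp: dev_def V_def \<sigma>_def col row \<mu> split: if_splits)
    ultimately show "a \<in> ?B" using a by (auto simp: tables_def flow_configs_def)
  next
    fix a assume a: "a \<in> ?B"
    have colK: "(\<Sum>e\<in>{e\<in>E. snd e = j}. a e) = (\<beta>(m := k)) j" if "j \<in> K" for j
      using a that by (auto simp: tables_def)
    have "(\<Sum>j\<in>K. \<Sum>e\<in>{e\<in>E. snd e = j}. a e) = (\<Sum>j\<in>K. (\<beta>(m := k)) j)"
      using colK by simp
    also have "\<dots> = k + (\<Sum>j\<in>J. (\<beta>(m := k)) j)" using J by (simp add: K_def)
    also have "(\<Sum>j\<in>J. (\<beta>(m := k)) j) = sum \<beta> J" using J by (intro sum.cong) auto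
    \<comment> \<open>The sink column is not prescribed by the table; comparison of totals gives its
      sum.\<close>
    finally have rest: "(\<Sum>e\<in>{e\<in>E. snd e \<notin> K}. a e) = N - k"
      using sum_split_columns[OF E K(1), of a] tables_total[OF E R a] N by linarith
    have "count (edge_mset \<tau> E a) v = count (\<mu> k) v" for v
    proof (cases v)
      case (Inr z)
      then show ?thesis by (cases z) (simp_all add: col \<mu> rest colK)
    qed (simp add: col \<mu>)
    then have eq: "edge_mset \<tau> E a = \<mu> k" by (simp add: multiset_eq_iff)
    have "dev v (count (\<sigma> k a) v) = 0" if "v \<in> V" for v
      using a that by (auto simp: V_def \<sigma>_def eq dev_def row tables_def)
    then have "D k a = 0" by (simp add: D_def)
    then show "a \<in> ?A" using a eq by (auto simp: tables_def flow_configs_def)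
  qed
  have fin: "finite (flow_configs \<tau> E (\<mu> k))" for k by (rule finite_flow_configs[OF E])
  \<comment> \<open>The factor \<open>0 ^ D k a\<close> selects deviation zero, so this is the same
    sum as \<open>w\<close> with \<epsilon> = 0. Both the comparison with \<open>w\<close> and the
    limit follow from this form.\<close>
  have W: "table_weight E R \<alpha> (insert m J) (\<beta>(m := k)) y
      = (\<Sum>a\<in>flow_configs \<tau> E (\<mu> k). P a * 0 ^ D k a)" if "k \<le> N" for k
  proof -
    have "P a = (\<Prod>e\<in>{e\<in>E. snd e \<notin> K}. y (snd e) ^ a e)" for a
      unfolding P_def using E by (subst prod.inter_filter) (auto simp: t_def intro!: prod.cong)
    then have "table_weight E R \<alpha> (insert m J) (\<beta>(m := k)) y
       = (\<Sum>a\<in>{a \<in> flow_configs \<tau> E (\<mu> k). D k a = 0}. P a)"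
      unfolding tab[OF that] table_weight_def K_def[symmetric] by simp
    also have "\<dots> = (\<Sum>a\<in>flow_configs \<tau> E (\<mu> k). P a * 0 ^ D k a)"
      using fin by (subst sum.inter_filter) (auto simp: power_0_left intro!: sum.cong)
    finally show ?thesis .
  qed
  show thesis
  proof (rule that[of w])
    show "w \<epsilon> k > 0" if "0 < \<epsilon>" "\<epsilon> \<le> 1" for \<epsilon> k
      using lor[OF that] by (simp add: lorentzian_def w_def)
    show "w \<epsilon> k * w \<epsilon> (k + 2) \<le> (w \<epsilon> (k + 1))\<^sup>2" if "0 < \<epsilon>" "\<epsilon> \<le> 1" "k + 2 \<le> N" for \<epsilon> k
    proof -
      \<comment> \<open>Raising k by one exchanges a sink element for an element of column
        \<open>m\<close>. Three consecutive values of k are thus the three entries of a two-by-two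
        minor over a common multiset \<nu>.\<close>
      define n where "n = N - k - 2"
      define \<nu> where "\<nu> = (\<Sum>j\<in>J. replicate_mset (\<beta> j) (Inr (Some j) :: 'a + 'b option))
        + replicate_mset k (Inr (Some m)) + replicate_mset n (Inr None)"
      let ?u = "Inr (Some m) :: 'a + 'b option" and ?v = "Inr None :: 'a + 'b option"
      have n: "N - k = Suc (Suc n)" "N - (k + 1) = Suc n" "N - (k + 2) = n"
        using that by (auto simp: n_def)
      have "\<mu> k = add_mset ?v (add_mset ?v \<nu>)" "\<mu> (k + 1) = add_mset ?u (add_mset ?v \<nu>)"
        "\<mu> (k + 2) = add_mset ?u (add_mset ?u \<nu>)"
        unfolding \<mu>_def n by (simp_all add: \<nu>_def)
      then show ?thesis
        using lorentzian_log_concave[OF lor[OF that(1,2)] V, of ?u ?v \<nu>] K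
        by (simp add: w_def V_def mult.commute)
    qed
    show "table_weight E R \<alpha> (insert m J) (\<beta>(m := k)) y \<le> w \<epsilon> k" if "0 < \<epsilon>" "k \<le> N" for \<epsilon> k
      unfolding W[OF that(2)] w using that Ppos
      by (intro sum_mono mult_left_mono) (auto simp: power_0_left less_imp_le)
    show "((\<lambda>\<epsilon>. w \<epsilon> k) \<longlongrightarrow> table_weight E R \<alpha> (insert m J) (\<beta>(m := k)) y) (at_right 0)"
      if "k \<le> N" for k
      unfolding W[OF that] w by (intro tendsto_intros)
  qed
qed

text \<open>Tables are grouped by the sum of column \<open>m\<close>. The columns in
  \<open>J\<close> leave only \<open>N\<close> units, which bounds the degree in
  \<open>x\<close>.\<close>

lemma table_weight_expand:
  assumes E: "finite E" and R: "finite R" "fst ` E \<subseteq> R" and J: "finite J" "m \<notin> J"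
    and N: "sum \<alpha> R = sum \<beta> J + N"
  shows "table_weight E R \<alpha> J \<beta> (y(m := x)) =
    (\<Sum>k\<le>N. table_weight E R \<alpha> (insert m J) (\<beta>(m := k)) y * x ^ k)"
proof -
  define C where "C = (\<lambda>a :: _ \<Rightarrow> nat. \<Sum>e\<in>{e\<in>E. snd e = m}. a e)"
  define P where "P = (\<lambda>a. \<Prod>e\<in>{e\<in>E. snd e \<notin> insert m J}. y (snd e) ^ a e)"
  have fin: "finite (tables E R \<alpha> J \<beta>)" by (rule finite_tables[OF E R])
  have prod: "(\<Prod>e\<in>{e\<in>E. snd e \<notin> J}. (y(m := x)) (snd e) ^ a e) = P a * x ^ C a" for a :: "_ \<Rightarrow> nat"
  proof -
    have split: "{e\<in>E. snd e \<notin> J} = {e\<in>E. snd e \<notin> insert m J} \<union> {e\<in>E. snd e = m}" using J by auto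
    have "(\<Prod>e\<in>{e\<in>E. snd e \<notin> J}. (y(m := x)) (snd e) ^ a e) =
        (\<Prod>e\<in>{e\<in>E. snd e \<notin> insert m J}. (y(m := x)) (snd e) ^ a e) *
        (\<Prod>e\<in>{e\<in>E. snd e = m}. (y(m := x)) (snd e) ^ a e)"
      by (subst split, rule prod.union_disjoint) (use E in auto)
    also have "(\<Prod>e\<in>{e\<in>E. snd e \<notin> insert m J}. (y(m := x)) (snd e) ^ a e) = P a"
      unfolding P_def by (intro prod.cong) auto
    also have "(\<Prod>e\<in>{e\<in>E. snd e = m}. (y(m := x)) (snd e) ^ a e) = x ^ C a"
      unfolding C_def power_sum by (intro prod.cong) auto
    finally show ?thesis .
  qed
  have "C ` tables E R \<alpha> J \<beta> \<subseteq> {..N}"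
  proof clarify
    fix a assume a: "a \<in> tables E R \<alpha> J \<beta>"
    have "C a \<le> (\<Sum>e\<in>{e\<in>E. snd e \<notin> J}. a e)"
      unfolding C_def using E J by (intro sum_mono2) auto
    moreover have "(\<Sum>j\<in>J. \<Sum>e\<in>{e\<in>E. snd e = j}. a e) = sum \<beta> J"
      using a by (simp add: tables_def)
    ultimately show "C a \<le> N"
      using sum_split_columns[OF E J(1), of a] tables_total[OF E R a] N by linarith
  qed
  then have "table_weight E R \<alpha> J \<beta> (y(m := x)) =
      (\<Sum>k\<le>N. \<Sum>a\<in>{a\<in>tables E R \<alpha> J \<beta>. C a = k}. P a * x ^ C a)"
    unfolding table_weight_def prod using fin by (intro sum.group[symmetric]) auto
  also have "\<dots> = (\<Sum>k\<le>N. table_weight E R \<alpha> (insert m J) (\<beta>(m := k)) y * x ^ k)"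
  proof (intro sum.cong refl)
    fix k
    have "{a\<in>tables E R \<alpha> J \<beta>. C a = k} = tables E R \<alpha> (insert m J) (\<beta>(m := k))"
      using J by (auto simp: tables_def C_def)
    then show "(\<Sum>a\<in>{a\<in>tables E R \<alpha> J \<beta>. C a = k}. P a * x ^ C a)
        = table_weight E R \<alpha> (insert m J) (\<beta>(m := k)) y * x ^ k"
      unfolding table_weight_def P_def[symmetric] by (simp add: sum_distrib_right C_def tables_def)
  qed
  finally show ?thesis .
qed

text \<open>The capacity argument: a lower bound by a monomial at every positive \<open>x\<close>
  passes to the coefficient of that monomial. Coefficients may vanish, so log-concave positive
  approximations are used and \<epsilon> tends to 0 at the end.\<close>

lemma table_weight_extract:
  assumes E: "finite E" and R: "finite R" "fst ` E \<subseteq> R" and J: "finite J" "m \<notin> J"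
    and y: "\<And>j. y j > 0" and le: "sum \<beta> (insert m J) \<le> sum \<alpha> R"
    and cap: "\<And>x. x > 0 \<Longrightarrow> table_weight E R \<alpha> J \<beta> (y(m := x)) \<ge> A * x ^ \<beta> m"
  shows "table_weight E R \<alpha> (insert m J) \<beta> y \<ge> A * cap_factor (\<beta> m)"
proof -
  define N where "N = sum \<alpha> R - sum \<beta> J"
  have N: "sum \<alpha> R = sum \<beta> J + N" and mN: "\<beta> m \<le> N" using le J by (simp_all add: N_def)
  define W where "W = (\<lambda>k. table_weight E R \<alpha> (insert m J) (\<beta>(m := k)) y)"
  have cap: "A * x ^ \<beta> m \<le> (\<Sum>k\<le>N. W k * x ^ k)" if "x > 0" for x
    using cap[OF that] unfolding W_def table_weight_expand[OF E R J N] .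
  have "A * cap_factor (\<beta> m) \<le> W (\<beta> m)"
  \<comment> \<open>The point used in \<open>log_concave_sum_le\<close> refers to index k - 1, hence
    the separate case. Letting \<open>x\<close> tend to 0 there gives the constant coefficient
    without loss.\<close>
  proof (cases "\<beta> m = 0")
    case True
    have "((\<lambda>x. \<Sum>k\<le>N. W k * x ^ k) \<longlongrightarrow> (\<Sum>k\<le>N. W k * 0 ^ k)) (at_right 0)"
      by (intro tendsto_intros)
    moreover have "(\<Sum>k\<le>N. W k * 0 ^ k) = W 0"
      by (simp add: power_0_left if_distrib cong: if_cong)
    moreover have "\<forall>\<^sub>F x in at_right 0. A \<le> (\<Sum>k\<le>N. W k * x ^ k)"
      using cap True by (simp add: eventually_at_right_less eventually_mono[OF eventually_at_right_less])
    ultimately have "A \<le> W 0" by (metis tendsto_lowerbound trivial_limit_at_right_real)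
    then show ?thesis using True by (simp add: cap_factor_def)
  next
    case False
    obtain w :: "real \<Rightarrow> nat \<Rightarrow> real" where w: "\<And>\<epsilon> k. 0 < \<epsilon> \<Longrightarrow> \<epsilon> \<le> 1 \<Longrightarrow> w \<epsilon> k > 0"
      "\<And>\<epsilon> k. 0 < \<epsilon> \<Longrightarrow> \<epsilon> \<le> 1 \<Longrightarrow> k + 2 \<le> N \<Longrightarrow> w \<epsilon> k * w \<epsilon> (k + 2) \<le> (w \<epsilon> (k + 1))\<^sup>2"
      "\<And>\<epsilon> k. 0 < \<epsilon> \<Longrightarrow> k \<le> N \<Longrightarrow> W k \<le> w \<epsilon> k"
      "\<And>k. k \<le> N \<Longrightarrow> ((\<lambda>\<epsilon>. w \<epsilon> k) \<longlongrightarrow> W k) (at_right 0)"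
      unfolding W_def by (rule table_weight_log_concave_approx[where y = y, OF E R J y N]) blast
    have "A * cap_factor (\<beta> m) \<le> w \<epsilon> (\<beta> m)" if \<epsilon>: "0 < \<epsilon>" "\<epsilon> \<le> 1" for \<epsilon>
    proof -
      \<comment> \<open>This point varies with \<epsilon>, but its power cancels before the limit is
        taken.\<close>
      define x where "x = real (\<beta> m) / real (\<beta> m + 1) * (w \<epsilon> (\<beta> m - 1) / w \<epsilon> (\<beta> m))"
      have "x > 0" using w(1)[OF \<epsilon>] False by (simp add: x_def)
      have "cap_factor (\<beta> m) * (A * x ^ \<beta> m) \<le> cap_factor (\<beta> m) * (\<Sum>k\<le>N. w \<epsilon> k * x ^ k)"
      proof (intro mult_left_mono)
        have "(\<Sum>k\<le>N. W k * x ^ k) \<le> (\<Sum>k\<le>N. w \<epsilon> k * x ^ k)"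
          using w(3)[OF \<epsilon>(1)] \<open>x > 0\<close> by (intro sum_mono mult_right_mono) auto
        then show "A * x ^ \<beta> m \<le> (\<Sum>k\<le>N. w \<epsilon> k * x ^ k)" using cap[OF \<open>x > 0\<close>] by linarith
      qed (use cap_factor_pos less_imp_le in blast)
      also have "\<dots> \<le> w \<epsilon> (\<beta> m) * x ^ \<beta> m"
        using False mN w(1,2)[OF \<epsilon>] by (intro log_concave_sum_le) (auto simp: x_def)
      finally have "(A * cap_factor (\<beta> m)) * x ^ \<beta> m \<le> w \<epsilon> (\<beta> m) * x ^ \<beta> m" by (simp add: mult_ac)
      then show ?thesis using \<open>x > 0\<close> by simp
    qed
    then have "\<forall>\<^sub>F \<epsilon> in at_right 0. A * cap_factor (\<beta> m) \<le> w \<epsilon> (\<beta> m)"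
      unfolding eventually_at_right_field by (intro exI[of _ 1]) auto
    then show ?thesis using w(4)[OF mN] by (metis tendsto_lowerbound trivial_limit_at_right_real)
  qed
  then show ?thesis by (simp add: W_def)
qed

subsection \<open>Extracting the rows\<close>

lemma log_concave_cross:
  fixes c :: "nat \<Rightarrow> real"
  assumes pos: "\<And>j. c j > 0" and lc: "\<And>j. c j * c (j + 2) \<le> (c (j + 1))\<^sup>2" and "i \<le> j"
  shows "c i * c (j + 1) \<le> c (i + 1) * c j"
  using \<open>i \<le> j\<close>
proof (induction j rule: dec_induct)
  case (step j)
  have "c (Suc j + 1) / c (Suc j) \<le> c (Suc j) / c j"
    using lc[of j] pos[of j] pos[of "Suc j"] by (simp add: field_simps power2_eq_square)
  also have "\<dots> \<le> c (i + 1) / c i"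
    using step.IH pos[of j] pos[of i] by (simp add: field_simps)
  finally show ?case using pos[of i] pos[of "Suc j"] by (simp add: field_simps)
qed (simp add: mult.commute)

text \<open>By the recursion \<open>d (k + 1) = c (k + 1) + z * d k\<close>, the terms with
  \<open>z\<close> cancel, and \<open>d k * c (k + 2) \<le> d (k + 1) * c (k + 1)\<close> remains;
  it holds term by term through \<open>log_concave_cross\<close>.\<close>

lemma log_concave_geometric_convolution:
  fixes c :: "nat \<Rightarrow> real"
  assumes pos: "\<And>j. c j > 0" and lc: "\<And>j. c j * c (j + 2) \<le> (c (j + 1))\<^sup>2" and "z \<ge> 0"
  defines "d \<equiv> \<lambda>k. \<Sum>j\<le>k. z ^ j * c (k - j)"
  shows "d k * d (k + 2) \<le> (d (k + 1))\<^sup>2"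
proof -
  have rec: "d (k + 1) = c (k + 1) + z * d k" for k
    by (simp add: d_def sum.atMost_Suc_shift sum_distrib_left mult.assoc del: sum.atMost_Suc)
  have "d k * c (k + 2) = (\<Sum>j\<le>k. z ^ j * (c (k - j) * c (k + 2)))"
    by (simp add: d_def sum_distrib_right mult.assoc)
  also have "\<dots> \<le> (\<Sum>j\<le>k. z ^ j * (c (k + 1 - j) * c (k + 1)))"
  proof (intro sum_mono mult_left_mono)
    fix j assume "j \<in> {..k}"
    then have "k - j + 1 = k + 1 - j" by auto
    then show "c (k - j) * c (k + 2) \<le> c (k + 1 - j) * c (k + 1)"
      using log_concave_cross[OF pos lc, of "k - j" "k + 1"] by (simp add: numeral_2_eq_2)
  qed (use \<open>z \<ge> 0\<close> in simp)
  also have "\<dots> = (\<Sum>j\<le>k. z ^ j * c (k + 1 - j)) * c (k + 1)"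
    by (simp add: sum_distrib_right mult.assoc)
  \<comment> \<open>The sum on the left lacks only the last term of \<open>d (k + 1)\<close>, which
    is nonnegative.\<close>
  also have "\<dots> \<le> d (k + 1) * c (k + 1)"
    using pos[of 0] pos[of "k + 1"] \<open>z \<ge> 0\<close> by (intro mult_right_mono) (auto simp: d_def intro!: less_imp_le)
  finally have "d k * c (k + 2) \<le> d (k + 1) * c (k + 1)" .
  moreover have "d (k + 2) = c (k + 2) + z * d (k + 1)" using rec[of "k + 1"] by simp
  ultimately show ?thesis using rec[of k] by (simp add: power2_eq_square algebra_simps)
qed

section \<open>Complete homogeneous polynomials, the generating functions of single rows\<close>

definition complete_hom :: "('e \<Rightarrow> real) \<Rightarrow> 'e set \<Rightarrow> nat \<Rightarrow> real" where
  "complete_hom z S k = (\<Sum>a\<in>{a \<in> S \<rightarrow>\<^sub>E UNIV. sum a S = k}. \<Prod>e\<in>S. z e ^ a e)"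

lemma finite_compositions:
  assumes "finite S"
  shows "finite {a \<in> S \<rightarrow>\<^sub>E (UNIV :: nat set). sum a S = k}"
proof (rule finite_subset)
  show "{a \<in> S \<rightarrow>\<^sub>E UNIV. sum a S = k} \<subseteq> S \<rightarrow>\<^sub>E {..k}"
    using assms by (auto intro!: PiE_I dest: PiE_arb intro: member_le_sum)
qed (use assms in \<open>auto intro: finite_PiE\<close>)

lemma complete_hom_empty: "complete_hom z {} k = (if k = 0 then 1 else 0)"
  by (simp add: complete_hom_def)

lemma complete_hom_0:
  assumes "finite S"
  shows "complete_hom z S 0 = 1"
proof -
  have "{a \<in> S \<rightarrow>\<^sub>E (UNIV :: nat set). sum a S = 0} = {\<lambda>e\<in>S. 0}"
    using assms by (auto simp: PiE_iff extensional_def fun_eq_iff)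
  then show ?thesis by (simp add: complete_hom_def)
qed

text \<open>Splitting off the exponent of one variable puts the polynomials into the shape of
  \<open>log_concave_geometric_convolution\<close>.\<close>

lemma complete_hom_insert:
  assumes S: "finite S" "e \<notin> S"
  shows "complete_hom z (insert e S) k = (\<Sum>j\<le>k. z e ^ j * complete_hom z S (k - j))"
proof -
  have sum_upd: "sum (a(e := j)) S = sum a S" for a :: "'a \<Rightarrow> nat" and j
    using S by (intro sum.cong) auto
  have prod_upd: "(\<Prod>e'\<in>S. z e' ^ (a(e := j)) e') = (\<Prod>e'\<in>S. z e' ^ a e')" for a :: "'a \<Rightarrow> nat" and j
    using S by (intro prod.cong) auto
  define F where "F = (\<lambda>j. {a \<in> S \<rightarrow>\<^sub>E (UNIV :: nat set). sum a S = k - j})"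
  have "(\<Sum>j\<le>k. z e ^ j * complete_hom z S (k - j))
      = (\<Sum>(j, a)\<in>Sigma {..k} F. z e ^ j * (\<Prod>e\<in>S. z e ^ a e))"
    unfolding complete_hom_def sum_distrib_left F_def
    using finite_compositions[OF S(1)] by (intro sum.Sigma) auto
  also have "\<dots> = complete_hom z (insert e S) k"
    unfolding complete_hom_def
  proof (rule sum.reindex_bij_witness[of _ "\<lambda>b. (b e, b(e := undefined))" "\<lambda>(j, a). a(e := j)"], goal_cases)
    case (1 p)
    then show ?case using S(2) by (auto simp: F_def PiE_def extensional_def fun_eq_iff)
  next
    case (2 p)
    then show ?case using S by (auto simp: F_def sum_upd PiE_iff extensional_def simp del: fun_upd_apply) auto
  next
    case (3 b)
    then show ?case by simp
  next
    case (4 b)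
    then show ?case using S by (auto simp: F_def sum_upd PiE_iff extensional_def simp del: fun_upd_apply) auto
  next
    case (5 p)
    then show ?case using S by (auto simp: prod_upd simp del: fun_upd_apply) simp
  qed
  finally show ?thesis by simp
qed

text \<open>Induction over the variables, starting from the geometric sequence of a single one; with
  no variables positivity would fail for k > 0.\<close>

lemma complete_hom_pos_log_concave:
  assumes "finite S" "S \<noteq> {}" "\<And>e. e \<in> S \<Longrightarrow> z e > 0"
  shows "(\<forall>k. complete_hom z S k > 0) \<and>
    (\<forall>k. complete_hom z S k * complete_hom z S (k + 2) \<le> (complete_hom z S (k + 1))\<^sup>2)"
  using assms
proof (induction S rule: finite_ne_induct)
  case (singleton e)
  have "complete_hom z {e} k = z e ^ k" for k
  proof -
    have "(\<Sum>j\<le>k. z e ^ j * complete_hom z {} (k - j)) = (\<Sum>j\<in>{k}. z e ^ j * complete_hom z {} (k - j))"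
      by (intro sum.mono_neutral_right) (auto simp: complete_hom_empty)
    then show ?thesis by (simp add: complete_hom_insert complete_hom_empty)
  qed
  then show ?case using singleton by (simp add: power2_eq_square)
next
  case (insert e S)
  have "z e > 0" using insert.prems by simp
  moreover have pos: "complete_hom z S k > 0" and
    lc: "complete_hom z S k * complete_hom z S (k + 2) \<le> (complete_hom z S (k + 1))\<^sup>2" for k
    using insert.IH insert.prems by auto
  ultimately show ?case
    unfolding complete_hom_insert[OF insert.hyps(1,3)]
    by (intro conjI allI sum_pos log_concave_geometric_convolution) auto
qed

text \<open>A truncated form of expanding the product of the series
  \<open>1 / (1 - x * z e)\<close>. Truncation makes it usable before convergence is known.\<close>

lemma prod_geometric_le_complete_hom:
  assumes S: "finite S" and z: "\<And>e. e \<in> S \<Longrightarrow> z e > 0" and "x > 0"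
  shows "(\<Prod>e\<in>S. \<Sum>k\<le>K. (x * z e) ^ k) \<le> (\<Sum>k\<le>K * card S. complete_hom z S k * x ^ k)"
proof -
  have "(\<Prod>e\<in>S. \<Sum>k\<le>K. (x * z e) ^ k) = (\<Sum>a\<in>S \<rightarrow>\<^sub>E {..K}. \<Prod>e\<in>S. (x * z e) ^ a e)"
    using S by (simp add: prod_sum_PiE)
  also have "\<dots> = (\<Sum>k\<le>K * card S. \<Sum>a\<in>{a\<in>S \<rightarrow>\<^sub>E {..K}. sum a S = k}. \<Prod>e\<in>S. (x * z e) ^ a e)"
  proof (rule sum.group[symmetric])
    show "(\<lambda>a. sum a S) ` (S \<rightarrow>\<^sub>E {..K}) \<subseteq> {..K * card S}"
    proof clarify
      fix a :: "'a \<Rightarrow> nat" assume "a \<in> S \<rightarrow>\<^sub>E {..K}"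
      then have "sum a S \<le> of_nat (card S) * K" by (intro sum_bounded_above) (auto simp: PiE_iff)
      then show "sum a S \<le> K * card S" by (simp add: mult.commute)
    qed
  qed (use S in \<open>auto intro: finite_PiE\<close>)
  also have "\<dots> \<le> (\<Sum>k\<le>K * card S. complete_hom z S k * x ^ k)"
  proof (rule sum_mono)
    fix k
    have "(\<Sum>a\<in>{a\<in>S \<rightarrow>\<^sub>E {..K}. sum a S = k}. \<Prod>e\<in>S. (x * z e) ^ a e)
        \<le> (\<Sum>a\<in>{a\<in>S \<rightarrow>\<^sub>E UNIV. sum a S = k}. \<Prod>e\<in>S. (x * z e) ^ a e)"
      using S z \<open>x > 0\<close> by (intro sum_mono2 finite_compositions) (auto intro!: prod_nonneg simp: less_imp_le)
    also have "\<dots> = complete_hom z S k * x ^ k"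
      unfolding complete_hom_def sum_distrib_right
      by (intro sum.cong refl) (auto simp: power_mult_distrib prod.distrib mult.commute power_sum)
    finally show "(\<Sum>a\<in>{a\<in>S \<rightarrow>\<^sub>E {..K}. sum a S = k}. \<Prod>e\<in>S. (x * z e) ^ a e)
        \<le> complete_hom z S k * x ^ k" .
  qed
  finally show ?thesis .
qed

text \<open>The infimum of \<open>q powr (- a) / (1 - q)\<close> over 0 < q < 1; for natural
  \<open>a\<close> it is the inverse of \<open>cap_factor a\<close>.\<close>

definition geom_cap :: "real \<Rightarrow> real" where
  "geom_cap a = selfpow (a + 1) / selfpow a"

lemma selfpow_pos: "x \<ge> 0 \<Longrightarrow> selfpow x > 0"
  by (simp add: selfpow_def)

lemma geom_cap_pos: "a \<ge> 0 \<Longrightarrow> geom_cap a > 0"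
  by (simp add: geom_cap_def selfpow_pos)

text \<open>Concavity of the logarithm: \<open>ln t \<le> t - 1\<close> is used at
  \<open>q * (a + 1) / a\<close> with weight \<open>a\<close> and at
  \<open>(1 - q) * (a + 1)\<close> with weight 1, and the two right-hand sides cancel. Both are
  equalities at \<open>q = a / (a + 1)\<close>.\<close>

lemma geom_cap_le:
  assumes "a \<ge> 0" "0 < q" "q < 1"
  shows "geom_cap a * q powr a \<le> 1 / (1 - q)"
proof (cases "a = 0")
  case True
  then show ?thesis using assms by (simp add: geom_cap_def selfpow_def field_simps)
next
  case False
  then have "a > 0" using assms by simp
  have "a * ln (q * (a + 1) / a) \<le> a * (q * (a + 1) / a - 1)"
    using \<open>a > 0\<close> assms by (intro mult_left_mono ln_le_minus_one) auto
  moreover have "ln ((1 - q) * (a + 1)) \<le> (1 - q) * (a + 1) - 1"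
    using \<open>a > 0\<close> assms by (intro ln_le_minus_one) auto
  moreover have "a * (q * (a + 1) / a - 1) + ((1 - q) * (a + 1) - 1) = 0"
    using \<open>a > 0\<close> by (simp add: field_simps)
  moreover have "ln (q * (a + 1) / a) = ln q + ln (a + 1) - ln a" "ln ((1 - q) * (a + 1)) = ln (1 - q) + ln (a + 1)"
    using \<open>a > 0\<close> assms by (simp_all add: ln_mult ln_div)
  ultimately have "a * (ln q + ln (a + 1) - ln a) + (ln (1 - q) + ln (a + 1)) \<le> 0" by simp
  then have "(a + 1) * ln (a + 1) - a * ln a + a * ln q \<le> - ln (1 - q)"
    by (simp add: algebra_simps)
  then have "exp ((a + 1) * ln (a + 1) - a * ln a + a * ln q) \<le> exp (- ln (1 - q))" by simp
  then show ?thesis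
    using \<open>a > 0\<close> assms by (simp add: geom_cap_def selfpow_def powr_def exp_add exp_diff exp_minus inverse_eq_divide)
qed

text \<open>Log-concavity bounds the coefficient below by the whole series at one point
  \<open>x\<close>. The series is a product of geometric series, each estimated by
  \<open>geom_cap_le\<close>; since the exponents \<open>A e\<close> add up to k, the powers of
  \<open>x\<close> cancel.\<close>

lemma complete_hom_lower_bound:
  assumes S: "finite S" and z: "\<And>e. e \<in> S \<Longrightarrow> z e > 0" and A: "\<And>e. e \<in> S \<Longrightarrow> A e \<ge> 0"
    and k: "(\<Sum>e\<in>S. A e) = real k"
  shows "complete_hom z S k \<ge> cap_factor k * (\<Prod>e\<in>S. geom_cap (A e) * z e powr A e)"
proof (cases "k = 0")
  case True
  then have "A e = 0" if "e \<in> S" for e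
    using k A S that by (simp add: sum_nonneg_eq_0_iff)
  then show ?thesis
    using True z S by (simp add: complete_hom_0 cap_factor_def geom_cap_def selfpow_def less_imp_neq[symmetric])
next
  case False
  then have "S \<noteq> {}" using k by auto
  define c where "c = complete_hom z S"
  have pos: "c j > 0" and lc: "c j * c (j + 2) \<le> (c (j + 1))\<^sup>2" for j
    using complete_hom_pos_log_concave[OF S \<open>S \<noteq> {}\<close> z] by (auto simp: c_def)
  define x where "x = real k / real (k + 1) * (c (k - 1) / c k)"
  have "x > 0" using pos False by (simp add: x_def)
  define B where "B = c k * x ^ k / cap_factor k"
  have sum_le: "(\<Sum>j\<le>N. c j * x ^ j) \<le> B" for N
  proof -
    \<comment> \<open>\<open>log_concave_sum_le\<close> needs index k inside the range, hence the
      maximum.\<close>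
    have "(\<Sum>j\<le>N. c j * x ^ j) \<le> (\<Sum>j\<le>max N k. c j * x ^ j)"
      using pos \<open>x > 0\<close> by (intro sum_mono2) (auto simp: less_imp_le)
    moreover have "cap_factor k * (\<Sum>j\<le>max N k. c j * x ^ j) \<le> c k * x ^ k"
      using False pos lc by (intro log_concave_sum_le) (auto simp: x_def)
    moreover have "cap_factor k * (\<Sum>j\<le>N. c j * x ^ j) \<le> cap_factor k * (\<Sum>j\<le>max N k. c j * x ^ j)"
      using calculation(1) cap_factor_pos[of k] by (intro mult_left_mono) auto
    ultimately have "cap_factor k * (\<Sum>j\<le>N. c j * x ^ j) \<le> c k * x ^ k" by linarith
    then show ?thesis using cap_factor_pos[of k] by (simp add: B_def field_simps)
  qed
  have prod_le: "(\<Prod>e\<in>S. \<Sum>j\<le>K. (x * z e) ^ j) \<le> B" for K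
    using prod_geometric_le_complete_hom[where z = z and x = x and K = K, OF S z \<open>x > 0\<close>] sum_le[of "K * card S"] by (simp add: c_def)
  have ge1: "(\<Sum>j\<le>K. (x * z e) ^ j) \<ge> 1" if "e \<in> S" for e K
  proof -
    have "(\<Sum>j\<in>{0}. (x * z e) ^ j) \<le> (\<Sum>j\<le>K. (x * z e) ^ j)"
      using z[OF that] \<open>x > 0\<close> by (intro sum_mono2) auto
    then show ?thesis by simp
  qed
  \<comment> \<open>Convergence follows from the bound itself: otherwise the factor of
    \<open>e\<close> would be at least \<open>K\<close>, the others at least 1, and the product
    would exceed \<open>B\<close>.\<close>
  have lt1: "x * z e < 1" if "e \<in> S" for e
  proof (rule ccontr)
    assume "\<not> x * z e < 1"
    then have ge: "1 \<le> (x * z e) ^ j" for j by (intro one_le_power) simp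
    obtain K where K: "B < real K" using reals_Archimedean2 by blast
    have "real K \<le> (\<Sum>j\<le>K. 1 :: real)" by simp
    also have "\<dots> \<le> (\<Sum>j\<le>K. (x * z e) ^ j)" by (intro sum_mono ge)
    also have "\<dots> \<le> (\<Sum>j\<le>K. (x * z e) ^ j) * (\<Prod>e\<in>S - {e}. \<Sum>j\<le>K. (x * z e) ^ j)"
    proof -
      have "1 \<le> (\<Prod>e\<in>S - {e}. \<Sum>j\<le>K. (x * z e) ^ j)" by (intro prod_ge_1) (use ge1 in auto)
      then show ?thesis using ge1[OF that, of K] by (simp add: mult_le_cancel_left1)
    qed
    also have "\<dots> \<le> B" using prod_le[of K] S that by (simp add: prod.remove)
    finally show False using K by simp
  qed
  have "(\<lambda>K. \<Prod>e\<in>S. \<Sum>j\<le>K. (x * z e) ^ j) \<longlonglongrightarrow> (\<Prod>e\<in>S. 1 / (1 - x * z e))"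
  proof (intro tendsto_prod)
    fix e assume "e \<in> S"
    then have "(\<lambda>j. (x * z e) ^ j) sums (1 / (1 - x * z e))"
      using lt1[of e] mult_pos_pos[OF \<open>x > 0\<close> z[of e]] by (intro geometric_sums) auto
    then show "(\<lambda>K. \<Sum>j\<le>K. (x * z e) ^ j) \<longlonglongrightarrow> 1 / (1 - x * z e)" by (simp add: sums_def_le)
  qed
  then have lim: "(\<Prod>e\<in>S. 1 / (1 - x * z e)) \<le> B"
    using prod_le by (intro LIMSEQ_le_const2) auto
  have "x ^ k * (\<Prod>e\<in>S. geom_cap (A e) * z e powr A e) = (\<Prod>e\<in>S. geom_cap (A e) * (x * z e) powr A e)"
  proof -
    have "x ^ k = x powr (\<Sum>e\<in>S. A e)" using \<open>x > 0\<close> by (simp add: k powr_realpow)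
    also have "\<dots> = (\<Prod>e\<in>S. x powr A e)" using \<open>x > 0\<close> S by (simp add: powr_sum)
    finally have "x ^ k = (\<Prod>e\<in>S. x powr A e)" .
    then show ?thesis using z \<open>x > 0\<close> by (simp add: powr_mult less_imp_le prod.distrib[symmetric] mult_ac)
  qed
  also have "\<dots> \<le> (\<Prod>e\<in>S. 1 / (1 - x * z e))"
    using lt1 z A \<open>x > 0\<close> geom_cap_pos by (intro prod_mono) (auto intro!: geom_cap_le simp: less_imp_le)
  finally have "x ^ k * (\<Prod>e\<in>S. geom_cap (A e) * z e powr A e) \<le> B" using lim by linarith
  then have "x ^ k * (cap_factor k * (\<Prod>e\<in>S. geom_cap (A e) * z e powr A e)) \<le> x ^ k * c k"
    using cap_factor_pos[of k] by (simp add: B_def field_simps)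
  then show ?thesis using \<open>x > 0\<close> by (simp add: c_def)
qed

text \<open>Without column constraints the rows are independent, so a table is a free choice of one
  composition per row.\<close>

lemma table_weight_rows:
  assumes E: "finite E" and R: "finite R" "fst ` E \<subseteq> R"
  shows "table_weight E R \<alpha> {} \<beta> y =
    (\<Prod>i\<in>R. complete_hom (\<lambda>e. y (snd e)) {e\<in>E. fst e = i} (\<alpha> i))"
proof -
  define Ei where "Ei = (\<lambda>i. {e\<in>E. fst e = i})"
  define F where "F = (\<lambda>i. {a \<in> Ei i \<rightarrow>\<^sub>E (UNIV :: nat set). sum a (Ei i) = \<alpha> i})"
  have finEi: "finite (Ei i)" for i using E by (simp add: Ei_def)
  have "(\<Prod>i\<in>R. complete_hom (\<lambda>e. y (snd e)) (Ei i) (\<alpha> i))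
      = (\<Sum>g\<in>Pi\<^sub>E R F. \<Prod>i\<in>R. \<Prod>e\<in>Ei i. y (snd e) ^ g i e)"
    unfolding complete_hom_def F_def
    using R(1) finite_compositions[OF finEi] by (rule prod_sum_PiE)
  also have "\<dots> = (\<Sum>a\<in>tables E R \<alpha> {} \<beta>. \<Prod>e\<in>E. y (snd e) ^ a e)"
  proof (rule sum.reindex_bij_witness[of _ "\<lambda>a. \<lambda>i\<in>R. restrict a (Ei i)" "\<lambda>g. \<lambda>e\<in>E. g (fst e) e"])
    fix g assume g: "g \<in> Pi\<^sub>E R F"
    have gF: "g i \<in> Ei i \<rightarrow>\<^sub>E UNIV" "sum (g i) (Ei i) = \<alpha> i" if "i \<in> R" for i
      using g that by (auto simp: F_def PiE_iff)
    show "(\<lambda>i\<in>R. restrict (\<lambda>e\<in>E. g (fst e) e) (Ei i)) = g"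
    proof
      fix i
      show "(\<lambda>i\<in>R. restrict (\<lambda>e\<in>E. g (fst e) e) (Ei i)) i = g i"
      proof (cases "i \<in> R")
        case True
        have "restrict (\<lambda>e\<in>E. g (fst e) e) (Ei i) e = g i e" for e
          using PiE_arb[OF gF(1)[OF True], of e] by (auto simp: Ei_def restrict_def)
        then show ?thesis using True by auto
      next
        case False
        then show ?thesis using PiE_arb[OF g] by simp
      qed
    qed
    have "(\<Sum>e\<in>Ei i. (\<lambda>e\<in>E. g (fst e) e) e) = \<alpha> i" if "i \<in> R" for i
      using gF(2)[OF that] by (intro trans[OF sum.cong gF(2)[OF that]]) (auto simp: Ei_def)
    then show "(\<lambda>e\<in>E. g (fst e) e) \<in> tables E R \<alpha> {} \<beta>"
      by (simp add: tables_def Ei_def)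
    have "(\<Prod>e\<in>E. y (snd e) ^ (\<lambda>e\<in>E. g (fst e) e) e) = (\<Prod>e\<in>E. y (snd e) ^ g (fst e) e)"
      by (intro prod.cong) auto
    also have "\<dots> = (\<Prod>i\<in>R. \<Prod>e\<in>Ei i. y (snd e) ^ g (fst e) e)"
      unfolding Ei_def using E R by (rule prod.group[symmetric])
    also have "\<dots> = (\<Prod>i\<in>R. \<Prod>e\<in>Ei i. y (snd e) ^ g i e)"
      by (intro prod.cong refl) (auto simp: Ei_def)
    finally show "(\<Prod>e\<in>E. y (snd e) ^ (\<lambda>e\<in>E. g (fst e) e) e) = (\<Prod>i\<in>R. \<Prod>e\<in>Ei i. y (snd e) ^ g i e)" .
  next
    fix a assume a: "a \<in> tables E R \<alpha> {} \<beta>"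
    show "(\<lambda>e\<in>E. (\<lambda>i\<in>R. restrict a (Ei i)) (fst e) e) = a"
    proof
      fix e
      show "(\<lambda>e\<in>E. (\<lambda>i\<in>R. restrict a (Ei i)) (fst e) e) e = a e"
        using a R PiE_arb[of a E "\<lambda>_. UNIV" e] by (cases "e \<in> E") (auto simp: tables_def Ei_def)
    qed
    show "(\<lambda>i\<in>R. restrict a (Ei i)) \<in> Pi\<^sub>E R F"
    proof (rule PiE_I)
      fix i assume "i \<in> R"
      have "sum (restrict a (Ei i)) (Ei i) = sum a (Ei i)" by (intro sum.cong) auto
      then show "(\<lambda>i\<in>R. restrict a (Ei i)) i \<in> F i"
        using a \<open>i \<in> R\<close> unfolding F_def Ei_def tables_def by simp
    qed simp
  qed
  finally show ?thesis unfolding table_weight_def Ei_def by simp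
qed

text \<open>The last column \<open>j0\<close> costs nothing because its sum is forced by the other margins.\<close>

theorem card_tables_lower_bound:
  fixes E :: "('a \<times> 'b) set" and A :: "'a \<times> 'b \<Rightarrow> real"
  assumes E: "finite E" and R: "finite R" "fst ` E \<subseteq> R" and C: "finite C" "snd ` E \<subseteq> C" and "j0 \<in> C"
    and A: "\<And>e. e \<in> E \<Longrightarrow> A e \<ge> 0"
    and rows: "\<And>i. i \<in> R \<Longrightarrow> (\<Sum>e\<in>{e\<in>E. fst e = i}. A e) = real (\<alpha> i)"
    and cols: "\<And>j. j \<in> C \<Longrightarrow> (\<Sum>e\<in>{e\<in>E. snd e = j}. A e) = real (\<beta> j)"
  shows "real (card (tables E R \<alpha> C \<beta>)) \<ge>
    (\<Prod>i\<in>R. cap_factor (\<alpha> i)) * (\<Prod>j\<in>C - {j0}. cap_factor (\<beta> j)) * (\<Prod>e\<in>E. geom_cap (A e))"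
proof -
  define Cap where "Cap = (\<Prod>i\<in>R. cap_factor (\<alpha> i)) * (\<Prod>e\<in>E. geom_cap (A e))"
  have "real (sum \<alpha> R) = sum A E"
    using rows sum.group[OF E R, of A] by simp
  also have "\<dots> = real (sum \<beta> C)"
    using cols sum.group[OF E C, of A] by simp
  finally have total: "sum \<alpha> R = sum \<beta> C" by (simp only: of_nat_eq_iff)
  \<comment> \<open>Induction on the set of extracted columns: each extraction trades the power
    \<open>y m ^ \<beta> m\<close> for the factor \<open>cap_factor (\<beta> m)\<close>.\<close>
  have main: "\<forall>y. (\<forall>j. y j > 0) \<longrightarrow> table_weight E R \<alpha> J \<beta> y \<ge>
      Cap * (\<Prod>j\<in>J. cap_factor (\<beta> j)) * (\<Prod>j\<in>C - J. y j ^ \<beta> j)" if "finite J" "J \<subseteq> C" for J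
    using that
  proof (induction J)
    case empty
    show ?case
    proof (intro allI impI)
      fix y :: "'b \<Rightarrow> real" assume y: "\<forall>j. y j > 0"
      \<comment> \<open>The column sums of \<open>A\<close> distribute the power of each column
        variable over the cells of that column; its row sums then allow a bound row by row.\<close>
      have "(\<Prod>j\<in>C. y j ^ \<beta> j) = (\<Prod>j\<in>C. \<Prod>e\<in>{e\<in>E. snd e = j}. y (snd e) powr A e)"
      proof (intro prod.cong refl)
        fix j assume "j \<in> C"
        have "y j > 0" using y by blast
        have "y j ^ \<beta> j = y j powr (\<Sum>e\<in>{e\<in>E. snd e = j}. A e)"
          using \<open>y j > 0\<close> by (simp add: cols[OF \<open>j \<in> C\<close>] powr_realpow)
        also have "\<dots> = (\<Prod>e\<in>{e\<in>E. snd e = j}. y (snd e) powr A e)"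
          using \<open>y j > 0\<close> E by (simp add: powr_sum)
        finally show "y j ^ \<beta> j = \<dots>" .
      qed
      also have "\<dots> = (\<Prod>e\<in>E. y (snd e) powr A e)" using E C by (rule prod.group)
      finally have "Cap * (\<Prod>j\<in>C. y j ^ \<beta> j)
          = (\<Prod>i\<in>R. cap_factor (\<alpha> i)) * (\<Prod>e\<in>E. geom_cap (A e) * y (snd e) powr A e)"
        by (simp add: Cap_def prod.distrib)
      also have "\<dots> = (\<Prod>i\<in>R. cap_factor (\<alpha> i) * (\<Prod>e\<in>{e\<in>E. fst e = i}. geom_cap (A e) * y (snd e) powr A e))"
        unfolding prod.distrib[of _ _ R] by (subst prod.group[OF E R]) simp
      also have "\<dots> \<le> (\<Prod>i\<in>R. complete_hom (\<lambda>e. y (snd e)) {e\<in>E. fst e = i} (\<alpha> i))"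
      proof (intro prod_mono conjI)
        fix i assume "i \<in> R"
        show "0 \<le> cap_factor (\<alpha> i) * (\<Prod>e\<in>{e\<in>E. fst e = i}. geom_cap (A e) * y (snd e) powr A e)"
          using A cap_factor_pos geom_cap_pos by (intro mult_nonneg_nonneg prod_nonneg) (auto simp: less_imp_le)
        show "cap_factor (\<alpha> i) * (\<Prod>e\<in>{e\<in>E. fst e = i}. geom_cap (A e) * y (snd e) powr A e)
            \<le> complete_hom (\<lambda>e. y (snd e)) {e\<in>E. fst e = i} (\<alpha> i)"
          using complete_hom_lower_bound[of "{e\<in>E. fst e = i}" "\<lambda>e. y (snd e)" A "\<alpha> i"] E y A rows[OF \<open>i \<in> R\<close>]
          by simp
      qed
      also have "\<dots> = table_weight E R \<alpha> {} \<beta> y" by (rule table_weight_rows[OF E R, symmetric])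
      finally show "Cap * (\<Prod>j\<in>{}. cap_factor (\<beta> j)) * (\<Prod>j\<in>C - {}. y j ^ \<beta> j) \<le> table_weight E R \<alpha> {} \<beta> y"
        by simp
    qed
  next
    case (insert m J)
    show ?case
    proof (intro allI impI)
      fix y :: "'b \<Rightarrow> real" assume y: "\<forall>j. y j > 0"
      \<comment> \<open>Everything in the induction hypothesis that does not depend on the variable
        of column \<open>m\<close>.\<close>
      define B where "B = Cap * (\<Prod>j\<in>J. cap_factor (\<beta> j)) * (\<Prod>j\<in>C - insert m J. y j ^ \<beta> j)"
      have "B * x ^ \<beta> m \<le> table_weight E R \<alpha> J \<beta> (y(m := x))" if "x > 0" for x
      proof -
        have CJ: "C - J = insert m (C - insert m J)" using insert by auto
        have "(\<Prod>j\<in>C - J. (y(m := x)) j ^ \<beta> j) = x ^ \<beta> m * (\<Prod>j\<in>C - insert m J. (y(m := x)) j ^ \<beta> j)"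
          unfolding CJ using C by (subst prod.insert) auto
        also have "(\<Prod>j\<in>C - insert m J. (y(m := x)) j ^ \<beta> j) = (\<Prod>j\<in>C - insert m J. y j ^ \<beta> j)"
          by (intro prod.cong) auto
        finally have "B * x ^ \<beta> m = Cap * (\<Prod>j\<in>J. cap_factor (\<beta> j)) * (\<Prod>j\<in>C - J. (y(m := x)) j ^ \<beta> j)"
          by (simp add: B_def mult_ac)
        moreover have "\<forall>j. (y(m := x)) j > 0" using y that by simp
        ultimately show ?thesis using insert.IH insert.prems by (metis insert_subset)
      qed
      moreover have "sum \<beta> (insert m J) \<le> sum \<alpha> R"
        unfolding total using insert.prems C by (intro sum_mono2) auto
      ultimately have "B * cap_factor (\<beta> m) \<le> table_weight E R \<alpha> (insert m J) \<beta> y"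
        using insert.hyps y by (intro table_weight_extract[OF E R]) auto
      then show "Cap * (\<Prod>j\<in>insert m J. cap_factor (\<beta> j)) * (\<Prod>j\<in>C - insert m J. y j ^ \<beta> j)
          \<le> table_weight E R \<alpha> (insert m J) \<beta> y"
        using insert.hyps by (simp add: B_def mult_ac)
    qed
  qed
  let ?J = "C - {j0}"
  have "table_weight E R \<alpha> ?J \<beta> (\<lambda>_. 1) \<ge> Cap * (\<Prod>j\<in>?J. cap_factor (\<beta> j))"
    using main[of ?J] C by (auto dest: spec[of _ "\<lambda>_. 1"])
  moreover have "tables E R \<alpha> ?J \<beta> = tables E R \<alpha> C \<beta>"
  proof (intro equalityI subsetI)
    fix a assume a: "a \<in> tables E R \<alpha> ?J \<beta>"
    have "sum \<beta> C = (\<Sum>j\<in>C. \<Sum>e\<in>{e\<in>E. snd e = j}. a e)"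
      using tables_total[OF E R a] total sum.group[OF E C, of a] by simp
    also have "\<dots> = (\<Sum>e\<in>{e\<in>E. snd e = j0}. a e) + sum \<beta> ?J"
      using a C \<open>j0 \<in> C\<close> by (simp add: sum.remove tables_def)
    finally have "(\<Sum>e\<in>{e\<in>E. snd e = j0}. a e) = \<beta> j0"
      using C \<open>j0 \<in> C\<close> by (simp add: sum.remove)
    then show "a \<in> tables E R \<alpha> C \<beta>" using a by (auto simp: tables_def)
  qed (auto simp: tables_def)
  ultimately show ?thesis by (simp add: table_weight_def Cap_def mult_ac)
qed

subsection \<open>Integer flows as staircase tables\<close>

text \<open>A cell with \<open>i + j < n\<close> stands for the edge from i to \<open>n - j\<close>;
  a cell with \<open>i + j = n\<close> holds slack that completes the margins to partial sums of
  \<open>N\<close>. The bounds on i and j leave out the corners \<open>(0, n)\<close> and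
  \<open>(n, 0)\<close>.\<close>

definition staircase :: "nat \<Rightarrow> (nat \<times> nat) set" where
  "staircase n = {(i, j). i < n \<and> j < n \<and> i + j \<le> n}"

lemma finite_staircase: "finite (staircase n)"
  by (rule finite_subset[of _ "{..<n} \<times> {..<n}"]) (auto simp: staircase_def)

lemma staircase_row_sum:
  fixes g :: "nat \<times> nat \<Rightarrow> 'a::comm_monoid_add"
  assumes "i < n"
  shows "(\<Sum>e\<in>{e\<in>staircase n. fst e = i}. g e) = (\<Sum>j<n - i. g (i, j)) + (if i = 0 then 0 else g (i, n - i))"
proof -
  have "{e\<in>staircase n. fst e = i} = Pair i ` ({..<n - i} \<union> (if i = 0 then {} else {n - i}))"
    using assms by (auto simp: staircase_def)
  then show ?thesis by (simp add: sum.reindex inj_on_def add.commute)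
qed

lemma staircase_col_sum:
  fixes g :: "nat \<times> nat \<Rightarrow> 'a::comm_monoid_add"
  assumes "j < n"
  shows "(\<Sum>e\<in>{e\<in>staircase n. snd e = j}. g e) = (\<Sum>i<n - j. g (i, j)) + (if j = 0 then 0 else g (n - j, j))"
proof -
  have "{e\<in>staircase n. snd e = j} = (\<lambda>i. (i, j)) ` ({..<n - j} \<union> (if j = 0 then {} else {n - j}))"
    using assms by (auto simp: staircase_def)
  then show ?thesis by (simp add: sum.reindex inj_on_def add.commute)
qed

lemma sum_reflect:
  fixes g :: "nat \<Rightarrow> 'a::comm_monoid_add"
  assumes "i \<le> n"
  shows "(\<Sum>j\<in>{i<..n}. g j) = (\<Sum>j<n - i. g (n - j))"
  by (rule sum.reindex_bij_witness[of _ "\<lambda>j. n - j" "\<lambda>j. n - j"]) (use assms in auto)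

text \<open>Conservation across a cut, obtained by moving one vertex at a time to the left side:
  edges inside the left side cancel.\<close>

lemma flow_polytope_cut:
  assumes f: "f \<in> flow_polytope n N" and "i \<le> n"
  shows "(\<Sum>k<i. of_int (N k)) = (\<Sum>k<i. \<Sum>j\<in>{i..n}. f k j)"
  using \<open>i \<le> n\<close>
proof (induction i)
  case (Suc i)
  have vertex: "of_int (N i) = (\<Sum>j\<in>{i<..n}. f i j) - (\<Sum>k<i. f k i)"
    using f Suc.prems by (auto simp: flow_polytope_def)
  have split: "{i..n} = insert i {Suc i..n}" using Suc.prems by auto
  have "(\<Sum>k<i. \<Sum>j\<in>{i..n}. f k j) = (\<Sum>k<i. f k i) + (\<Sum>k<i. \<Sum>j\<in>{Suc i..n}. f k j)"
    unfolding split by (simp add: sum.distrib)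
  then show ?case
    using Suc vertex by (simp add: atLeastSucAtMost_greaterThanAtMost)
qed simp

context
  fixes n :: nat and N :: "nat \<Rightarrow> int" and f :: "nat \<Rightarrow> nat \<Rightarrow> real"
  assumes n: "n \<ge> 1" and N: "N n = - (\<Sum>i<n. N i)" and f: "f \<in> flow_polytope n N"
begin

lemma flow_nonneg: "f i j \<ge> 0"
  using f by (cases "i < j \<and> j \<le> n") (auto simp: flow_polytope_def)

text \<open>A slack entry is the flow that passes over vertex i: what crosses the cut before i minus
  what ends at i.\<close>

lemma A_mat_nonneg:
  assumes "(i, j) \<in> staircase n"
  shows "A_mat n N f i j \<ge> 0"
proof (cases "i + j \<le> n - 1")
  case True
  then show ?thesis by (simp add: A_mat_def flow_nonneg)
next
  case False
  then have i: "i + j = n" "1 \<le> i" "i \<le> n" using assms by (auto simp: staircase_def)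
  have "(\<Sum>k<i. f k i) \<le> (\<Sum>k<i. \<Sum>j\<in>{i..n}. f k j)"
    using i flow_nonneg by (intro sum_mono member_le_sum) auto
  then have "0 \<le> (\<Sum>k<i. of_int (N k) - f k i)"
    using flow_polytope_cut[OF f i(3)] by (simp add: sum_subtractf)
  then show ?thesis using False i by (simp add: A_mat_def)
qed

text \<open>The row contains the outflow of vertex i, which is \<open>N i\<close> plus the inflow;
  the slack is the preceding partial sum minus the same inflow.\<close>

lemma A_mat_row_sum:
  assumes "i < n"
  shows "(\<Sum>e\<in>{e\<in>staircase n. fst e = i}. A_mat n N f (fst e) (snd e)) = of_int (\<Sum>j\<le>i. N j)"
proof -
  have "(\<Sum>j<n - i. A_mat n N f i j) = (\<Sum>j<n - i. f i (n - j))"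
    by (intro sum.cong) (auto simp: A_mat_def)
  also have "\<dots> = (\<Sum>j\<in>{i<..n}. f i j)" using assms by (simp add: sum_reflect)
  also have "\<dots> = of_int (N i) + (\<Sum>k<i. f k i)"
  proof -
    have "(\<Sum>j\<in>{i<..n}. f i j) - (\<Sum>k<i. f k i) = of_int (N i)"
      using f assms by (auto simp: flow_polytope_def)
    then show ?thesis by linarith
  qed
  finally have 1: "(\<Sum>j<n - i. A_mat n N f i j) = of_int (N i) + (\<Sum>k<i. f k i)" .
  have 2: "(if i = 0 then 0 else A_mat n N f i (n - i)) = (\<Sum>k<i. of_int (N k)) - (\<Sum>k<i. f k i)"
    using assms by (auto simp: A_mat_def sum_subtractf)
  show ?thesis
    unfolding staircase_row_sum[OF assms] fst_conv snd_conv using 1 2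
    by (simp add: lessThan_Suc_atMost[symmetric] del: if_split)
qed

text \<open>The column contains the inflow of vertex \<open>n - j\<close>, which the slack
  completes. Column 0 has no slack: the inflow of vertex n is \<open>- N n\<close>, already the full
  sum.\<close>

lemma A_mat_col_sum:
  assumes "j < n"
  shows "(\<Sum>e\<in>{e\<in>staircase n. snd e = j}. A_mat n N f (fst e) (snd e)) = of_int (\<Sum>k\<le>n - 1 - j. N k)"
proof -
  have "(\<Sum>i<n - j. A_mat n N f i j) = (\<Sum>i<n - j. f i (n - j))"
    by (intro sum.cong) (auto simp: A_mat_def)
  moreover have "{..n - 1 - j} = {..<n - j}" using assms by auto
  moreover have "(if j = 0 then 0 else A_mat n N f (n - j) j)
      = (\<Sum>k<n - j. of_int (N k)) - (\<Sum>k<n - j. f k (n - j))"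
  proof (cases "j = 0")
    case True
    have "(\<Sum>j\<in>{n<..n}. f n j) - (\<Sum>k<n. f k n) = of_int (N n)"
      using f unfolding flow_polytope_def by blast
    then show ?thesis using True N by simp
  next
    case False
    then show ?thesis using assms by (auto simp: A_mat_def sum_subtractf)
  qed
  ultimately show ?thesis
    unfolding staircase_col_sum[OF assms] fst_conv snd_conv by (simp only: of_int_sum)
qed

lemma partial_sum_nonneg:
  assumes "i < n"
  shows "(\<Sum>j\<le>i. N j) \<ge> 0"
proof -
  have "0 \<le> (\<Sum>e\<in>{e\<in>staircase n. fst e = i}. A_mat n N f (fst e) (snd e))"
    by (intro sum_nonneg A_mat_nonneg) auto
  then show ?thesis unfolding A_mat_row_sum[OF assms] by (simp only: of_int_0_le_iff)
qed

end

section \<open>The bijection between integer flows and tables\<close>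

definition flow_tables :: "nat \<Rightarrow> (nat \<Rightarrow> int) \<Rightarrow> (nat \<times> nat \<Rightarrow> nat) set" where
  "flow_tables n N = tables (staircase n) {..<n} (\<lambda>i. nat (\<Sum>j\<le>i. N j)) {..<n} (\<lambda>j. nat (\<Sum>k\<le>n - 1 - j. N k))"

definition table_flow :: "nat \<Rightarrow> (nat \<times> nat \<Rightarrow> nat) \<Rightarrow> nat \<Rightarrow> nat \<Rightarrow> real" where
  "table_flow n a i j = (if i < j \<and> j \<le> n then real (a (i, n - j)) else 0)"

text \<open>Row i and column \<open>n - i\<close> share the slack cell \<open>a (i, n - i)\<close>.
  It cancels in their difference, and the margins differ by \<open>N i\<close>, which is
  conservation at vertex i.\<close>

lemma table_flow_in_flow_polytope:
  assumes n: "n \<ge> 1" and N: "N n = - (\<Sum>i<n. N i)" and nonneg: "\<And>i. i < n \<Longrightarrow> (\<Sum>j\<le>i. N j) \<ge> 0"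
    and a: "a \<in> flow_tables n N"
  shows "table_flow n a \<in> flow_polytope n N"
proof -
  have row: "real (\<Sum>j<n - i. a (i, j)) + real (if i = 0 then 0 else a (i, n - i)) = of_int (\<Sum>j\<le>i. N j)" if "i < n" for i
  proof -
    have "(\<Sum>j<n - i. a (i, j)) + (if i = 0 then 0 else a (i, n - i)) = nat (\<Sum>j\<le>i. N j)"
      using a that by (simp add: flow_tables_def tables_def flip: staircase_row_sum)
    then show ?thesis using nonneg[OF that] by (metis of_nat_add of_nat_nat of_int_of_nat_eq)
  qed
  have col: "real (\<Sum>k<n - j. a (k, j)) + real (if j = 0 then 0 else a (n - j, j)) = of_int (\<Sum>k<n - j. N k)" if "j < n" for j
  proof -
    have "{..n - 1 - j} = {..<n - j}" using that by auto
    then have "(\<Sum>k<n - j. a (k, j)) + (if j = 0 then 0 else a (n - j, j)) = nat (\<Sum>k<n - j. N k)"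
      using a that by (simp add: flow_tables_def tables_def flip: staircase_col_sum)
    moreover have "(\<Sum>k<n - j. N k) \<ge> 0"
      using nonneg[of "n - 1 - j"] that \<open>{..n - 1 - j} = {..<n - j}\<close> by simp
    ultimately show ?thesis by (metis of_nat_add of_nat_nat of_int_of_nat_eq)
  qed
  have "(\<Sum>j\<in>{i<..n}. table_flow n a i j) - (\<Sum>k<i. table_flow n a k i) = of_int (N i)" if "i \<le> n" for i
  proof -
    have out: "(\<Sum>j\<in>{i<..n}. table_flow n a i j) = real (\<Sum>j<n - i. a (i, j))"
      using that by (simp add: sum_reflect table_flow_def)
    have inn: "(\<Sum>k<i. table_flow n a k i) = real (\<Sum>k<i. a (k, n - i))"
      using that by (simp add: table_flow_def)
    \<comment> \<open>The end vertices have no slack cell: at 0 the row alone decides, at n column 0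
      alone.\<close>
    consider "i = 0" | "i = n" | "0 < i" "i < n" using \<open>i \<le> n\<close> le_neq_implies_less by blast
    then show ?thesis
    proof cases
      case 1
      then show ?thesis using out inn row[of 0] n by simp
    next
      case 2
      then show ?thesis using out inn col[of 0] n N by simp
    next
      case 3
      have "{..i} = insert i {..<i}" by auto
      then show ?thesis using out inn row[of i] col[of "n - i"] 3 by simp
    qed
  qed
  then show ?thesis by (auto simp: flow_polytope_def table_flow_def)
qed

text \<open>The flow forgets only the slack cells. Each row has at most one, and the row sum
  determines it.\<close>

lemma inj_on_table_flow: "inj_on (table_flow n) (flow_tables n N)"
proof (rule inj_onI)
  fix a b assume a: "a \<in> flow_tables n N" and b: "b \<in> flow_tables n N"
    and eq: "table_flow n a = table_flow n b"
  have low: "a (i, j) = b (i, j)" if "i + j < n" for i j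
    using fun_cong[OF fun_cong[OF eq], of i "n - j"] that by (simp add: table_flow_def split: if_splits)
  have "a (i, n - i) = b (i, n - i)" if "0 < i" "i < n" for i
  proof -
    have "(\<Sum>j<n - i. a (i, j)) + a (i, n - i) = (\<Sum>j<n - i. b (i, j)) + b (i, n - i)"
      using a b that staircase_row_sum[of i n a] staircase_row_sum[of i n b]
      by (simp add: flow_tables_def tables_def)
    moreover have "(\<Sum>j<n - i. a (i, j)) = (\<Sum>j<n - i. b (i, j))"
      by (intro sum.cong) (auto intro: low)
    ultimately show ?thesis by simp
  qed
  then have on: "a e = b e" if "e \<in> staircase n" for e
  proof -
    obtain i j where "e = (i, j)" by (cases e)
    then have e: "e = (i, j)" "i < n" "j < n" "i + j \<le> n" using that by (auto simp: staircase_def)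
    show ?thesis
    proof (cases "i + j < n")
      case False
      then have "j = n - i" "0 < i" using e by auto
      then show ?thesis using \<open>\<And>i. 0 < i \<Longrightarrow> i < n \<Longrightarrow> a (i, n - i) = b (i, n - i)\<close> e by simp
    qed (use e low in simp)
  qed
  have "a \<in> staircase n \<rightarrow>\<^sub>E UNIV" "b \<in> staircase n \<rightarrow>\<^sub>E UNIV"
    using a b by (auto simp: flow_tables_def tables_def)
  then show "a = b" by (rule PiE_ext) (rule on)
qed

text \<open>The preimage is the matrix \<open>A_mat\<close> of the flow itself, whose entries are
  nonnegative integers when the flow is integral.\<close>

lemma integer_flow_in_image:
  assumes n: "n \<ge> 1" and N: "N n = - (\<Sum>i<n. N i)" and g: "g \<in> flow_polytope n N" "\<forall>i j. g i j \<in> \<int>"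
  shows "g \<in> table_flow n ` flow_tables n N"
proof -
  define a where "a = (\<lambda>e\<in>staircase n. nat \<lfloor>A_mat n N g (fst e) (snd e)\<rfloor>)"
  have a: "real (a e) = A_mat n N g (fst e) (snd e)" if "e \<in> staircase n" for e
  proof -
    have "A_mat n N g (fst e) (snd e) \<in> \<int>" using g(2) by (auto simp: A_mat_def intro!: Ints_sum Ints_diff)
    moreover have "A_mat n N g (fst e) (snd e) \<ge> 0" using A_mat_nonneg[OF n N g(1)] that by simp
    ultimately show ?thesis using that by (auto simp: a_def elim!: Ints_cases)
  qed
  have "sum a {e\<in>staircase n. fst e = i} = nat (\<Sum>j\<le>i. N j)" if "i < n" for i
  proof -
    have "real (sum a {e\<in>staircase n. fst e = i}) = of_int (\<Sum>j\<le>i. N j)"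
      using A_mat_row_sum[OF n N g(1) that] by (simp add: a)
    then show ?thesis by linarith
  qed
  moreover have "sum a {e\<in>staircase n. snd e = j} = nat (\<Sum>k\<le>n - 1 - j. N k)" if "j < n" for j
  proof -
    have "real (sum a {e\<in>staircase n. snd e = j}) = of_int (\<Sum>k\<le>n - 1 - j. N k)"
      using A_mat_col_sum[OF n N g(1) that] by (simp add: a)
    then show ?thesis by linarith
  qed
  ultimately have "a \<in> flow_tables n N" by (simp add: flow_tables_def tables_def a_def)
  moreover have "g = table_flow n a"
  proof (intro ext)
    fix i j
    show "g i j = table_flow n a i j"
    proof (cases "i < j \<and> j \<le> n")
      case True
      then have "(i, n - j) \<in> staircase n" by (auto simp: staircase_def)
      then show ?thesis using True by (auto simp: table_flow_def a A_mat_def)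
    next
      case False
      then show ?thesis using g(1) by (auto simp: flow_polytope_def table_flow_def)
    qed
  qed
  ultimately show ?thesis by blast
qed

lemma K_count_eq_card_tables:
  assumes n: "n \<ge> 1" and N: "N n = - (\<Sum>i<n. N i)" and nonneg: "\<And>i. i < n \<Longrightarrow> (\<Sum>j\<le>i. N j) \<ge> 0"
  shows "K_count n N = card (flow_tables n N)"
proof -
  have "{g \<in> flow_polytope n N. \<forall>i j. g i j \<in> \<int>} = table_flow n ` flow_tables n N"
    using integer_flow_in_image[OF n N] table_flow_in_flow_polytope[OF n N nonneg]
    by (auto simp: table_flow_def)
  then show ?thesis by (simp add: K_count_def card_image inj_on_table_flow)
qed

section \<open>The bound for flows\<close>

lemma cap_factor_eq_selfpow: "cap_factor k = selfpow (real k) / selfpow (real k + 1)"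
proof -
  have "selfpow (real m) = real m ^ m" for m
    by (simp add: selfpow_def powr_realpow)
  from this[of k] this[of "k + 1"] show ?thesis by (simp add: cap_factor_def add.commute)
qed

theorem theorem3p2:
  fixes n :: nat and N :: "nat \<Rightarrow> int" and f :: "nat \<Rightarrow> nat \<Rightarrow> real"
  assumes "n \<ge> 1"
    and "N n = - (\<Sum>i<n. N i)"
    and "f \<in> flow_polytope n N"
  shows "real (K_count n N) \<ge>
     Max ((\<lambda>i. selfpow (real_of_int (\<Sum>j\<le>i. N j) + 1) / selfpow (real_of_int (\<Sum>j\<le>i. N j))) ` {..<n})
     * (\<Prod>i<n. selfpow (real_of_int (\<Sum>j\<le>i. N j)) / selfpow (real_of_int (\<Sum>j\<le>i. N j) + 1)) ^ 2
     * (\<Prod>(i, j)\<in>{(i, j). i < n \<and> j < n \<and> i + j \<le> n}.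
          selfpow (A_mat n N f i j + 1) / selfpow (A_mat n N f i j))"
proof -
  define \<alpha> where "\<alpha> = (\<lambda>i. nat (\<Sum>j\<le>i. N j))"
  note nonneg = partial_sum_nonneg[OF assms]
  have \<alpha>: "real_of_int (\<Sum>j\<le>i. N j) = real (\<alpha> i)" if "i < n" for i
    using nonneg[OF that] by (simp add: \<alpha>_def)
  have tables: "flow_tables n N = tables (staircase n) {..<n} \<alpha> {..<n} (\<lambda>j. \<alpha> (n - 1 - j))"
    by (simp add: flow_tables_def \<alpha>_def)
  let ?G = "\<lambda>i. selfpow (real_of_int (\<Sum>j\<le>i. N j) + 1) / selfpow (real_of_int (\<Sum>j\<le>i. N j))"
  have G: "?G i = 1 / cap_factor (\<alpha> i)" if "i < n" for i
    unfolding \<alpha>[OF that] cap_factor_eq_selfpow by simp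
  have "Max (?G ` {..<n}) \<in> ?G ` {..<n}" using assms(1) by (intro Max_in) (auto simp: lessThan_empty_iff)
  \<comment> \<open>The row index attaining the maximum determines the free column: column
    \<open>n - 1 - i0\<close> has the same sum as row \<open>i0\<close>.\<close>
  then obtain i0 where i0: "i0 < n" "Max (?G ` {..<n}) = 1 / cap_factor (\<alpha> i0)" using G by auto
  have prod1: "(\<Prod>i<n. selfpow (real_of_int (\<Sum>j\<le>i. N j)) / selfpow (real_of_int (\<Sum>j\<le>i. N j) + 1))
      = (\<Prod>i<n. cap_factor (\<alpha> i))"
    by (intro prod.cong refl) (simp add: \<alpha> cap_factor_eq_selfpow del: of_int_sum)
  have prod2: "(\<Prod>(i, j)\<in>{(i, j). i < n \<and> j < n \<and> i + j \<le> n}.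
          selfpow (A_mat n N f i j + 1) / selfpow (A_mat n N f i j))
      = (\<Prod>e\<in>staircase n. geom_cap (A_mat n N f (fst e) (snd e)))"
    unfolding staircase_def by (intro prod.cong refl) (auto simp: geom_cap_def)
  have cols: "(\<Prod>j\<in>{..<n} - {n - 1 - i0}. cap_factor (\<alpha> (n - 1 - j))) = (\<Prod>i\<in>{..<n} - {i0}. cap_factor (\<alpha> i))"
    by (rule prod.reindex_bij_witness[of _ "\<lambda>i. n - 1 - i" "\<lambda>j. n - 1 - j"]) (use i0(1) in auto)
  have "(\<Prod>i<n. cap_factor (\<alpha> i)) = cap_factor (\<alpha> i0) * (\<Prod>i\<in>{..<n} - {i0}. cap_factor (\<alpha> i))"
    using i0(1) by (simp add: prod.remove)
  \<comment> \<open>The maximum cancels one factor \<open>cap_factor (\<alpha> i0)\<close> of the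
    square, namely that of the column which costs nothing.\<close>
  then have "Max (?G ` {..<n}) * (\<Prod>i<n. cap_factor (\<alpha> i)) ^ 2
      = (\<Prod>i<n. cap_factor (\<alpha> i)) * (\<Prod>j\<in>{..<n} - {n - 1 - i0}. cap_factor (\<alpha> (n - 1 - j)))"
    unfolding i0(2) cols using cap_factor_pos[of "\<alpha> i0"] by (simp add: power2_eq_square)
  moreover have "real (card (flow_tables n N)) \<ge>
      (\<Prod>i<n. cap_factor (\<alpha> i)) * (\<Prod>j\<in>{..<n} - {n - 1 - i0}. cap_factor (\<alpha> (n - 1 - j)))
      * (\<Prod>e\<in>staircase n. geom_cap (A_mat n N f (fst e) (snd e)))"
    unfolding tables
  proof (rule card_tables_lower_bound[where \<beta> = "\<lambda>j. \<alpha> (n - 1 - j)"])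
    show "A_mat n N f (fst e) (snd e) \<ge> 0" if "e \<in> staircase n" for e
      using A_mat_nonneg[OF assms] that by simp
    show "(\<Sum>e\<in>{e\<in>staircase n. fst e = i}. A_mat n N f (fst e) (snd e)) = real (\<alpha> i)" if "i \<in> {..<n}" for i
      using A_mat_row_sum[OF assms] \<alpha> that by simp
    show "(\<Sum>e\<in>{e\<in>staircase n. snd e = j}. A_mat n N f (fst e) (snd e)) = real (\<alpha> (n - 1 - j))"
      if "j \<in> {..<n}" for j
      using A_mat_col_sum[OF assms, of j] \<alpha>[of "n - 1 - j"] that by simp
  qed (use finite_staircase i0(1) in \<open>auto simp: staircase_def\<close>)
  moreover have "K_count n N = card (flow_tables n N)"
    using nonneg by (intro K_count_eq_card_tables assms(1,2)) auto
  ultimately show ?thesis unfolding prod1 prod2 by (simp only:)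
qed

end
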